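(* Let $n\ge 3$. The element $V$ (the volume of an $n$-simplex) is integral over the ring $R_2$ generated over $\mathbb{Q}$ by the areas $A_{ijk}$ of the $2$-faces of the simplex if and only if $n$ is even and $n\ge 6$.
   Context: Let $\ell_{ij}=\ell_{ji}$, $0\le i<j\le n$, be $\binom{n+1}{2}$ independent variables over $\mathbb{Q}$ (the edge lengths of an $n$-simplex with vertices $p_0,\dots,p_n$), put $s_{ij}=\ell_{ij}^2$, and let $\mathbb{F}$ be the algebraic closure of the field of rational functions $\mathbb{Q}(\ell_{ij})$. For pairwise distinct $i,j,k$ put $$S_{ijk}=\tfrac1{16}\left(2s_{ij}s_{jk}+2s_{jk}s_{ki}+2s_{ki}s_{ij}-s_{ij}^2-s_{jk}^2-s_{ki}^2\right),$$ and let $A_{ijk}=\sqrt{S_{ijk}}\in\mathbb{F}$ (area of the $2$-face $p_ip_jp_k$). Let $$W=\frac{(-1)^{n+1}}{2^n(n!)^2}\det M,$$ where $M$ is the symmetric $(n+2)\times(n+2)$ matrix with rows and columns indexed by $*,0,1,\dots,n$, with $M_{**}=0$, $M_{*i}=M_{i*}=1$, $M_{ii}=0$, $M_{ij}=s_{ij}$ for $i\ne j$ (Cayley--Menger formula for the square of the volume), and let $V=\sqrt{W}\in\mathbb{F}$. $R_2$ is the $\mathbb{Q}$-subalgebra of $\mathbb{F}$ generated by all $A_{ijk}$, $0\le i<j<k\le n$. *)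

theory Defs
  imports
    "HOL-Library.Poly_Mapping"
    "HOL-Computational_Algebra.Polynomial"
    "Jordan_Normal_Form.Determinant"
begin

inductive_set rat_subalgebra :: "'a::field_char_0 set \<Rightarrow> 'a set" for G :: "'a set" where
  of_rat: "of_rat q \<in> rat_subalgebra G"
| gen: "g \<in> G \<Longrightarrow> g \<in> rat_subalgebra G"
| add: "x \<in> rat_subalgebra G \<Longrightarrow> y \<in> rat_subalgebra G \<Longrightarrow> x + y \<in> rat_subalgebra G"
| mult: "x \<in> rat_subalgebra G \<Longrightarrow> y \<in> rat_subalgebra G \<Longrightarrow> x * y \<in> rat_subalgebra G"

inductive_set rat_subfield :: "'a::field_char_0 set \<Rightarrow> 'a set" for G :: "'a set" where
  of_rat: "of_rat q \<in> rat_subfield G"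
| gen: "g \<in> G \<Longrightarrow> g \<in> rat_subfield G"
| add: "x \<in> rat_subfield G \<Longrightarrow> y \<in> rat_subfield G \<Longrightarrow> x + y \<in> rat_subfield G"
| mult: "x \<in> rat_subfield G \<Longrightarrow> y \<in> rat_subfield G \<Longrightarrow> x * y \<in> rat_subfield G"
| inverse: "x \<in> rat_subfield G \<Longrightarrow> inverse x \<in> rat_subfield G"

definition integral_over :: "'a::comm_ring_1 set \<Rightarrow> 'a \<Rightarrow> bool" where
  "integral_over R x \<longleftrightarrow>
     (\<exists>p :: 'a poly. lead_coeff p = 1 \<and> (\<forall>i. coeff p i \<in> R) \<and> poly p x = 0)"

text \<open>If the ambient field is algebraically closed, the following set is an algebraic closure
  of its subfield \<open>K\<close>.\<close>

definition algebraic_closure_in :: "'a::field set \<Rightarrow> 'a set" where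
  "algebraic_closure_in K =
     {x. \<exists>p :: 'a poly. p \<noteq> 0 \<and> (\<forall>i. coeff p i \<in> K) \<and> poly p x = 0}"

text \<open>Polynomials over the rationals in variables of type \<open>'v\<close> are finitely supported functions
  from monomials to coefficients, where a monomial is a finitely supported family of exponents.\<close>

definition eval_rat_mpoly ::
  "('v \<Rightarrow> 'a::field_char_0) \<Rightarrow> (('v \<Rightarrow>\<^sub>0 nat) \<Rightarrow>\<^sub>0 rat) \<Rightarrow> 'a" where
  "eval_rat_mpoly x p =
     (\<Sum>m\<in>Poly_Mapping.keys p. of_rat (Poly_Mapping.lookup p m) *
       (\<Prod>v\<in>Poly_Mapping.keys m. x v ^ Poly_Mapping.lookup m v))"

definition rat_algebraically_independent :: "('v \<Rightarrow> 'a::field_char_0) \<Rightarrow> 'v set \<Rightarrow> bool" where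
  "rat_algebraically_independent x E \<longleftrightarrow>
     (\<forall>p. (\<forall>m\<in>Poly_Mapping.keys p. Poly_Mapping.keys m \<subseteq> E) \<longrightarrow> eval_rat_mpoly x p = 0 \<longrightarrow> p = 0)"

definition edges :: "nat \<Rightarrow> (nat \<times> nat) set" where
  "edges n = {(i, j). i < j \<and> j \<le> n}"

definition independent_edge_lengths :: "nat \<Rightarrow> (nat \<Rightarrow> nat \<Rightarrow> 'a::field_char_0) \<Rightarrow> bool" where
  "independent_edge_lengths n l \<longleftrightarrow>
     (\<forall>i\<le>n. \<forall>j\<le>n. l i j = l j i) \<and>
     rat_algebraically_independent (\<lambda>(i, j). l i j) (edges n)"

definition length_field_closure :: "nat \<Rightarrow> (nat \<Rightarrow> nat \<Rightarrow> 'a::field_char_0) \<Rightarrow> 'a set" where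
  "length_field_closure n l =
     algebraic_closure_in (rat_subfield ((\<lambda>(i, j). l i j) ` edges n))"

definition area_square :: "(nat \<Rightarrow> nat \<Rightarrow> 'a::field_char_0) \<Rightarrow> nat \<Rightarrow> nat \<Rightarrow> nat \<Rightarrow> 'a" where
  "area_square l i j k =
     (let s = (\<lambda>a b. (l a b)\<^sup>2) in
      1 / 16 * (2 * s i j * s j k + 2 * s j k * s k i + 2 * s k i * s i j
                - (s i j)\<^sup>2 - (s j k)\<^sup>2 - (s k i)\<^sup>2))"

text \<open>Row and column \<open>0\<close> play the role of the index \<open>*\<close>; row and column \<open>Suc i\<close> belong to the
  vertex \<open>p\<^sub>i\<close>.\<close>

definition cayley_menger_mat :: "nat \<Rightarrow> (nat \<Rightarrow> nat \<Rightarrow> 'a::field_char_0) \<Rightarrow> 'a mat" where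
  "cayley_menger_mat n l = mat (n + 2) (n + 2) (\<lambda>(a, b).
     if a = b then 0
     else if a = 0 \<or> b = 0 then 1
     else (l (a - 1) (b - 1))\<^sup>2)"

definition volume_square :: "nat \<Rightarrow> (nat \<Rightarrow> nat \<Rightarrow> 'a::field_char_0) \<Rightarrow> 'a" where
  "volume_square n l =
     (-1) ^ (n + 1) / (2 ^ n * (fact n)\<^sup>2) * det (cayley_menger_mat n l)"

definition area_ring :: "nat \<Rightarrow> (nat \<Rightarrow> nat \<Rightarrow> nat \<Rightarrow> 'a::field_char_0) \<Rightarrow> 'a set" where
  "area_ring n A = rat_subalgebra {A i j k | i j k. i < j \<and> j < k \<and> k \<le> n}"

end

theory Submission
  imports Defs
begin

text \<open>Integrality over a \<open>\<rat>\<close>-subalgebra \<open>R\<close> of a field is tested on valuation rings: \<open>x\<close> is integral over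
  \<open>R\<close> if and only if it lies in every valuation ring that contains \<open>R\<close> (\<open>exists_valuation_ring\<close>,
  \<open>integrally_closed\<close>). A valuation ring contains an element as soon as it contains its square, so
  the question is whether the squared volume \<open>W\<close> lies in every valuation ring \<open>D\<close> that contains the
  squared areas of all \<open>2\<close>-faces.
  
  Let \<open>n\<close> be even and \<open>n \<ge> 6\<close>, and suppose that some squared edge length is not in \<open>D\<close>. Let \<open>T\<close> be the
  largest one, say that of the edge between the vertices \<open>0\<close> and \<open>1\<close>, and take it as the unit of
  measurement. With \<open>\<epsilon> = 1 / T\<close>, all squared areas become \<open>O(\<epsilon>\<^sup>2)\<close>: the simplex degenerates, all its
  triangles becoming flat. Let \<open>h\<close> be the Gram matrix, of order \<open>n - 1\<close>, of the components of the
  remaining vertices orthogonal to the longest edge. Up to a rational factor \<open>W\<close> is \<open>T\<^sup>n \<cdot> det h\<close>,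
  so \<open>det h = O(\<epsilon>\<^sup>n)\<close> has to be shown. The triangles that contain the vertex \<open>0\<close> or \<open>1\<close> show that the
  diagonal of \<open>h\<close> is \<open>O(\<epsilon>\<^sup>2)\<close> and that each other entry is either \<open>O(\<epsilon>)\<close> or close to a value that is
  determined by the positions along the longest edge.
  
  If all entries are \<open>O(\<epsilon>)\<close>, then those between vertices close to the same end of the longest edge are
  \<open>O(\<epsilon>\<^sup>2)\<close>. As the order of \<open>h\<close> is odd, every summand of the determinant contains such an entry, and
  \<open>det h = O(\<epsilon>\<^sup>n)\<close> follows (\<open>det_no_big_entry\<close>). Suppose now that an entry \<open>p = h\<^sub>i\<^sub>j\<close> exceeds \<open>\<epsilon>\<close>.
  The vertices \<open>0\<close>, \<open>1\<close>, \<open>i\<close>, \<open>j\<close> form a tetrahedron with nearly flat faces that is not flat itself. In this case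
  every further vertex is close to one of these four (\<open>fork\<close>, \<open>isolated\<close>); after splitting off
  the directions of \<open>i\<close> and \<open>j\<close> the inner products become \<open>O(\<epsilon>\<^sup>2 / p)\<close> (\<open>cross_in\<close>), and those of the same
  colour \<open>O(\<epsilon>\<^sup>2)\<close> (\<open>same_colour_cross\<close>). This gives \<open>det h = O(\<epsilon>\<^sup>n \<cdot> (\<epsilon> / p)\<^bsup>n-6\<^esup>)\<close> (\<open>det_big_entry\<close>), which
  suffices exactly because \<open>n \<ge> 6\<close>.
  
  For the other values of \<open>n\<close>, an integral equation of \<open>W\<close> over the ring generated by the squared areas
  would survive every specialisation of the independent edge lengths. So it is enough to find simplices
  with fixed areas and infinitely many volumes (\<open>volume_square_not_integral_family\<close>). For odd \<open>n\<close> these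
  are obtained from two groups of \<open>(n + 1) / 2\<close> vertices each, with distances \<open>0\<close> within the groups and
  large distances between them (\<open>split_simplex\<close>); for \<open>n = 4\<close>, from a large tetrahedron with flat
  faces and an apex over one of its vertices (\<open>apex_simplex\<close>). Extending the corresponding ring to a
  valuation ring that contains the squared areas but not \<open>W\<close> disposes of the square roots.\<close>

section \<open>Integrality and valuation rings\<close>

locale rat_algebra =
  fixes B :: "'a::field_char_0 set"
  assumes of_rat_closed [intro]: "of_rat q \<in> B"
    and add_closed [intro]: "x \<in> B \<Longrightarrow> y \<in> B \<Longrightarrow> x + y \<in> B"
    and mult_closed [intro]: "x \<in> B \<Longrightarrow> y \<in> B \<Longrightarrow> x * y \<in> B"
begin

lemma zero_closed [simp, intro]: "0 \<in> B"
  using of_rat_closed[of 0] by simp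

lemma one_closed [simp, intro]: "1 \<in> B"
  using of_rat_closed[of 1] by simp

lemma numeral_closed [simp, intro]: "numeral k \<in> B"
  using of_rat_closed[of "numeral k"] by simp

lemma uminus_closed [intro]: "x \<in> B \<Longrightarrow> - x \<in> B"
  using mult_closed[of "of_rat (-1)" x] of_rat_closed[of "-1"] by simp

lemma diff_closed [intro]: "x \<in> B \<Longrightarrow> y \<in> B \<Longrightarrow> x - y \<in> B"
  using add_closed[of x "- y"] by auto

lemma power_closed [intro]: "x \<in> B \<Longrightarrow> x ^ n \<in> B"
  by (induction n) auto

lemma sum_closed [intro]: "(\<And>i. i \<in> I \<Longrightarrow> f i \<in> B) \<Longrightarrow> sum f I \<in> B"
  by (induction I rule: infinite_finite_induct) auto

lemma prod_closed [intro]: "(\<And>i. i \<in> I \<Longrightarrow> f i \<in> B) \<Longrightarrow> prod f I \<in> B"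
  by (induction I rule: infinite_finite_induct) auto

lemma rat_subalgebra_least: "G \<subseteq> B \<Longrightarrow> rat_subalgebra G \<subseteq> B"
proof
  fix x assume "G \<subseteq> B" "x \<in> rat_subalgebra G"
  from this(2,1) show "x \<in> B" by induction auto
qed

end

lemma rat_algebra_rat_subalgebra: "rat_algebra (rat_subalgebra G)"
  by unfold_locales (auto intro: rat_subalgebra.intros)

definition adjoin :: "'a::field_char_0 set \<Rightarrow> 'a \<Rightarrow> 'a set" where
  "adjoin B z = {poly p z | p. \<forall>i. coeff p i \<in> B}"

lemma (in rat_algebra) rat_algebra_adjoin: "rat_algebra (adjoin B z)"
proof
  fix x y assume "x \<in> adjoin B z" "y \<in> adjoin B z"
  then obtain p q where pq: "x = poly p z" "y = poly q z" "\<And>i. coeff p i \<in> B" "\<And>i. coeff q i \<in> B"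
    unfolding adjoin_def by blast
  have "x + y = poly (p + q) z" "\<And>i. coeff (p + q) i \<in> B"
    using pq by auto
  then show "x + y \<in> adjoin B z" unfolding adjoin_def by blast
  have "x * y = poly (p * q) z" "\<And>i. coeff (p * q) i \<in> B"
    using pq by (auto simp: coeff_mult)
  then show "x * y \<in> adjoin B z" unfolding adjoin_def by blast
next
  fix q :: rat
  have "of_rat q = poly [:of_rat q:] z" "\<And>i. coeff [:of_rat q:] i \<in> B"
    by (auto simp: coeff_pCons split: nat.splits)
  then show "of_rat q \<in> adjoin B z" unfolding adjoin_def by blast
qed

lemma (in rat_algebra) subset_adjoin: "B \<subseteq> adjoin B z"
proof
  fix x assume "x \<in> B"
  then have "x = poly [:x:] z" "\<And>i. coeff [:x:] i \<in> B"
    by (auto simp: coeff_pCons split: nat.splits)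
  then show "x \<in> adjoin B z" unfolding adjoin_def by blast
qed

lemma (in rat_algebra) generator_in_adjoin: "z \<in> adjoin B z"
proof -
  have "z = poly [:0, 1:] z" "\<And>i. coeff [:0, 1:] i \<in> B"
    by (auto simp: coeff_pCons split: nat.splits)
  then show ?thesis unfolding adjoin_def by blast
qed

text \<open>Multiplying an expression of \<open>x\<close> as a polynomial of degree \<open>d\<close> in \<open>1 / x\<close> by \<open>x ^ d\<close> yields a
  monic equation of degree \<open>d + 1\<close>.\<close>

lemma (in rat_algebra) integral_if_in_adjoin_inverse:
  assumes "x \<in> adjoin B (inverse x)"
  shows "integral_over B x"
proof (cases "x = 0")
  case True
  have "lead_coeff [:0, 1 :: 'a:] = 1" "\<forall>i. coeff [:0, 1 :: 'a:] i \<in> B" "poly [:0, 1:] x = 0"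
    using True by (auto simp: coeff_pCons split: nat.splits)
  then show ?thesis unfolding integral_over_def by blast
next
  case x: False
  from assms obtain p where p: "x = poly p (inverse x)" "\<And>i. coeff p i \<in> B"
    unfolding adjoin_def by blast
  define d where "d = degree p"
  define r where "r = (\<Sum>i\<le>d. monom (coeff p i) (d - i))"
  define q where "q = monom 1 (Suc d) - r"
  have deg_r: "degree r < Suc d"
    unfolding r_def by (intro degree_sum_less) (auto simp: degree_monom_eq intro: le_less_trans[OF degree_monom_le])
  then have cr: "coeff r (Suc d) = 0" by (simp add: coeff_eq_0)
  have "degree q = Suc d"
    unfolding q_def using deg_r degree_add_eq_left[of "- r" "monom 1 (Suc d)"]
    by (simp add: degree_monom_eq)
  then have "lead_coeff q = 1" unfolding q_def by (simp add: cr)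
  moreover have "\<forall>i. coeff q i \<in> B"
    unfolding q_def r_def coeff_diff coeff_sum using p(2)
    by (intro allI diff_closed sum_closed) auto
  moreover have "poly q x = 0"
  proof -
    have "x ^ Suc d = x ^ d * poly p (inverse x)" using p(1) by simp
    also have "\<dots> = (\<Sum>i\<le>d. coeff p i * (x ^ d * inverse x ^ i))"
      unfolding poly_altdef d_def by (simp add: sum_distrib_left mult_ac)
    also have "\<dots> = (\<Sum>i\<le>d. coeff p i * x ^ (d - i))"
      by (intro sum.cong) (auto simp: power_diff x divide_inverse power_inverse)
    also have "\<dots> = poly r x" unfolding r_def by (simp add: poly_sum poly_monom)
    finally show ?thesis unfolding q_def by (simp add: poly_monom)
  qed
  ultimately show ?thesis unfolding integral_over_def by blast
qed

locale valuation_ring = rat_algebra +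
  assumes in_or_inverse_in: "x \<in> B \<or> inverse x \<in> B"

text \<open>Divide a monic equation of degree \<open>k + 1\<close> by \<open>x ^ k\<close>: if \<open>1 / x\<close> lay in the ring, \<open>x\<close> would be a
  combination of powers of \<open>1 / x\<close>.\<close>

lemma (in valuation_ring) integrally_closed:
  assumes "integral_over B x" shows "x \<in> B"
proof (rule ccontr)
  assume x: "x \<notin> B"
  then have x0: "x \<noteq> 0" and ix: "inverse x \<in> B" using in_or_inverse_in by auto
  from assms obtain p where p: "lead_coeff p = 1" "\<And>i. coeff p i \<in> B" "poly p x = 0"
    unfolding integral_over_def by blast
  define d where "d = degree p"
  have "d \<noteq> 0"
  proof
    assume "d = 0"
    then have "p = [:1:]" using p(1) unfolding d_def by (metis degree_0_id lead_coeff_pCons(2) degree_eq_zeroE pCons_0_0 coeff_pCons_0)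
    then show False using p(3) by simp
  qed
  then obtain k where k: "d = Suc k" using not0_implies_Suc by blast
  have "0 = inverse x ^ k * (\<Sum>i\<le>Suc k. coeff p i * x ^ i)"
    using p(3) unfolding poly_altdef d_def[symmetric] k by simp
  also have "\<dots> = inverse x ^ k * (\<Sum>i\<le>k. coeff p i * x ^ i) + x"
    using p(1) x0 unfolding d_def[symmetric] k by (simp add: field_simps)
  also have "inverse x ^ k * (\<Sum>i\<le>k. coeff p i * x ^ i) = (\<Sum>i\<le>k. coeff p i * inverse x ^ (k - i))"
    unfolding sum_distrib_left by (intro sum.cong) (auto simp: power_diff x0 field_simps)
  finally have "x = - (\<Sum>i\<le>k. coeff p i * inverse x ^ (k - i))" by (simp add: eq_neg_iff_add_eq_0 add.commute)
  also have "\<dots> \<in> B" using p(2) ix by blast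
  finally show False using x by simp
qed

lemma (in valuation_ring) in_if_square_in: 
  assumes "x\<^sup>2 \<in> B" shows "x \<in> B"
proof (rule ccontr)
  assume x: "x \<notin> B"
  then have "x \<noteq> 0" and "inverse x \<in> B" using in_or_inverse_in by auto
  then have "x\<^sup>2 * inverse x \<in> B" using assms by blast
  moreover have "x\<^sup>2 * inverse x = x" using \<open>x \<noteq> 0\<close> by (simp add: power2_eq_square)
  ultimately show False using x by simp
qed

text \<open>A relation that expresses \<open>1 / z\<close> as a polynomial in \<open>1 / y\<close> turns, after multiplication by
  \<open>z y ^ d\<close>, into a relation that expresses \<open>(1 - z c) y ^ d\<close> by lower powers of \<open>y\<close>, where \<open>c\<close> is
  the constant coefficient; the factor \<open>1 - z c\<close> can be cancelled.\<close>

lemma (in rat_algebra) power_eq_lower_poly: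
  assumes unit: "\<And>c. c \<in> B \<Longrightarrow> inverse (1 + z * c) \<in> B"
    and z: "z \<in> B" "inverse z \<notin> B" and y: "y \<noteq> 0"
    and q: "\<And>i. coeff q i \<in> B" "poly q (inverse y) = inverse z" "degree q \<le> d" and d: "0 < d"
  obtains r where "\<And>i. coeff r i \<in> B" "degree r < d" "poly r y = y ^ d"
proof -
  define u where "u = 1 + z * (- coeff q 0)"
  have z0: "z \<noteq> 0" using z by auto
  have u0: "u \<noteq> 0"
  proof
    assume "u = 0"
    then have "z * coeff q 0 = 1" by (simp add: u_def)
    then have "inverse z = coeff q 0" using inverse_unique by blast
    then show False using z q by simp
  qed
  have iu: "inverse u \<in> B" unfolding u_def using q(1) by (intro unit) auto
  define r where "r = (\<Sum>i\<in>{1..d}. monom (inverse u * z * coeff q i) (d - i))"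
  have "poly q (inverse y) = (\<Sum>i\<le>d. coeff q i * inverse y ^ i)"
    unfolding poly_altdef using q(3) by (intro sum.mono_neutral_left) (auto simp: coeff_eq_0)
  also have "{..d} = insert 0 {1..d}" by auto
  finally have "inverse z = coeff q 0 + (\<Sum>i\<in>{1..d}. coeff q i * inverse y ^ i)"
    using q(2) by simp
  then have "1 = z * (coeff q 0 + (\<Sum>i\<in>{1..d}. coeff q i * inverse y ^ i))"
    using z0 by (metis right_inverse)
  then have "u = z * (\<Sum>i\<in>{1..d}. coeff q i * inverse y ^ i)"
    unfolding u_def by (simp add: algebra_simps)
  then have "y ^ d * inverse u * z * (\<Sum>i\<in>{1..d}. coeff q i * inverse y ^ i) = y ^ d * (inverse u * u)"
    by (simp only: mult.assoc)
  then have "y ^ d = y ^ d * inverse u * z * (\<Sum>i\<in>{1..d}. coeff q i * inverse y ^ i)"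
    using u0 by simp
  also have "\<dots> = poly r y"
    unfolding r_def poly_sum sum_distrib_left
    by (intro sum.cong) (auto simp: poly_monom power_diff y divide_inverse power_inverse mult_ac)
  finally have "poly r y = y ^ d" by simp
  moreover have "degree r < d"
    unfolding r_def using d by (intro degree_sum_less) (auto intro: le_less_trans[OF degree_monom_le])
  moreover have "coeff r i \<in> B" for i
    unfolding r_def coeff_sum using iu z q by (intro sum_closed) auto
  ultimately show ?thesis using that by blast
qed

text \<open>The valuative criterion of integrality. Put \<open>z = 1 / x\<close>. As \<open>x\<close> is not integral, it is not a
  polynomial in \<open>z\<close>, so there is a maximal algebra \<open>D\<close> that contains \<open>B\<close> and \<open>z\<close> but not \<open>x\<close>. Such
  a \<open>D\<close> is a valuation ring: if neither \<open>y\<close> nor \<open>1 / y\<close> were in \<open>D\<close>, then by maximality \<open>x\<close> would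
  be a polynomial over \<open>D\<close> in \<open>y\<close> and also one in \<open>1 / y\<close>, and of two such polynomials of minimal
  degree each would serve to lower the degree of the other.\<close>

lemma (in rat_algebra) exists_valuation_ring:
  assumes "\<not> integral_over B x"
  obtains D where "valuation_ring D" "B \<subseteq> D" "x \<notin> D"
proof -
  define z where "z = inverse x"
  have iz: "inverse z = x" by (simp add: z_def)
  define F where "F = {D. rat_algebra D \<and> B \<subseteq> D \<and> z \<in> D \<and> x \<notin> D}"
  have "adjoin B z \<in> F"
    unfolding F_def using assms integral_if_in_adjoin_inverse
    by (auto simp: rat_algebra_adjoin subset_adjoin[THEN subsetD] generator_in_adjoin z_def)
  then have "F \<noteq> {}" by auto
  moreover have "\<Union>C \<in> F" if C: "C \<noteq> {}" "subset.chain F C" for C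
  proof -
    have alg: "D \<in> C \<Longrightarrow> rat_algebra D" for D
      using C(2) by (auto simp: subset.chain_def F_def)
    have common: "\<exists>D\<in>C. a \<in> D \<and> b \<in> D" if "a \<in> \<Union>C" "b \<in> \<Union>C" for a b
      using that C(2) unfolding subset.chain_def by blast
    have "rat_algebra (\<Union>C)"
    proof
      fix q :: rat show "of_rat q \<in> \<Union>C"
        using C(1) alg rat_algebra.of_rat_closed by blast
    next
      fix a b assume "a \<in> \<Union>C" "b \<in> \<Union>C"
      then obtain D where D: "D \<in> C" "a \<in> D" "b \<in> D" using common by blast
      then interpret D: rat_algebra D using alg by blast
      show "a + b \<in> \<Union>C" "a * b \<in> \<Union>C" using D by blast+
    qed
    then show ?thesis
      using C unfolding F_def subset.chain_def by blast
  qed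
  ultimately obtain D where D: "D \<in> F" and max: "\<And>X. X \<in> F \<Longrightarrow> D \<subseteq> X \<Longrightarrow> X = D"
    using subset_Zorn_nonempty[of F] by blast
  interpret D: rat_algebra D using D by (simp add: F_def)
  have B: "B \<subseteq> D" and z: "z \<in> D" "inverse z \<notin> D" using D by (auto simp: F_def iz)
  have z0: "z \<noteq> 0" using z by auto
  \<comment> \<open>Inverting the elements \<open>1 + z c\<close> does not invert \<open>z\<close>, so by maximality they are
    invertible already.\<close>
  have nz: "1 + z * c \<noteq> 0" if "c \<in> D" for c
  proof
    assume "1 + z * c = 0"
    then have "z * (- c) = 1" using add.inverse_unique[of "z * c" 1] by (simp add: add.commute)
    then have "inverse z = - c" using inverse_unique by blast
    then show False using z that by auto
  qed
  have unit: "inverse (1 + z * c) \<in> D" if c: "c \<in> D" for c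
  proof -
    define X where "X = {b * inverse (1 + z * c) | b c. b \<in> D \<and> c \<in> D}"
    have DX: "D \<subseteq> X"
    proof
      fix b assume "b \<in> D"
      then have "b = b * inverse (1 + z * 0) \<and> b \<in> D \<and> 0 \<in> D" by auto
      then show "b \<in> X" unfolding X_def by blast
    qed
    have "rat_algebra X"
    proof
      fix q :: rat show "of_rat q \<in> X" using DX by auto
    next
      fix a b assume "a \<in> X" "b \<in> X"
      then obtain a' b' c d where *: "a = a' * inverse (1 + z * c)" "b = b' * inverse (1 + z * d)"
        "a' \<in> D" "b' \<in> D" "c \<in> D" "d \<in> D" unfolding X_def by blast
      define f where "f = c + d + z * c * d"
      have f: "f \<in> D" "1 + z * f = (1 + z * c) * (1 + z * d)"
        unfolding f_def using * z by (auto simp: algebra_simps)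
      have "a + b = (a' * (1 + z * d) + b' * (1 + z * c)) * inverse (1 + z * f)"
        unfolding f(2) * using nz[OF *(5)] nz[OF *(6)] by (simp add: divide_simps)
      moreover have "a' * (1 + z * d) + b' * (1 + z * c) \<in> D" using * z by auto
      ultimately show "a + b \<in> X" unfolding X_def using f by blast
      have "a * b = (a' * b') * inverse (1 + z * f)"
        unfolding f(2) * by simp
      moreover have "a' * b' \<in> D" using * by auto
      ultimately show "a * b \<in> X" unfolding X_def using f by blast
    qed
    moreover have "inverse z \<notin> X"
    proof
      assume "inverse z \<in> X"
      then obtain b c where *: "inverse z = b * inverse (1 + z * c)" "b \<in> D" "c \<in> D"
        unfolding X_def by blast
      then have "1 + z * c = z * b" using nz[OF *(3)] z0 by (simp add: field_simps)
      then have "z * (b - c) = 1" by (simp add: algebra_simps)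
      then have "inverse z = b - c" using inverse_unique by blast
      then show False using z * by auto
    qed
    ultimately have "X = D" using max[of X] DX B z by (auto simp: F_def iz)
    moreover have "1 * inverse (1 + z * c) \<in> X" unfolding X_def using c D.one_closed by blast
    ultimately show ?thesis by simp
  qed
  have ex_poly: "\<exists>p. (\<forall>i. coeff p i \<in> D) \<and> poly p y = inverse z" if "y \<notin> D" for y
  proof -
    have "adjoin D y \<notin> F"
      using max[of "adjoin D y"] D.subset_adjoin[of y] D.generator_in_adjoin[of y] that by auto
    then have "x \<in> adjoin D y"
      unfolding F_def using D.rat_algebra_adjoin D.subset_adjoin[of y] B z by auto
    then obtain p where "x = poly p y" "\<forall>i. coeff p i \<in> D" unfolding adjoin_def by blast
    then show ?thesis unfolding iz by blast
  qed
  define good where "good y p \<longleftrightarrow> (\<forall>i. coeff p i \<in> D) \<and> poly p y = inverse z" for y p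
  \<comment> \<open>The leading power of \<open>y\<close> in \<open>p\<close> is replaced by lower ones.\<close>
  have reduce: "\<exists>p'. good y p' \<and> degree p' < degree p"
    if p: "good y p" and q: "good (inverse y) q" and le: "degree q \<le> degree p" and y0: "y \<noteq> 0" for y p q
  proof -
    have d: "0 < degree p"
    proof (rule ccontr)
      assume "\<not> 0 < degree p"
      then obtain c where "p = [:c:]" by (metis degree_eq_zeroE gr0I)
      then have "inverse z = coeff p 0" using p by (auto simp: good_def)
      then show False using p z by (auto simp: good_def)
    qed
    obtain r where r: "\<And>i. coeff r i \<in> D" "degree r < degree p" "poly r y = y ^ degree p"
      using D.power_eq_lower_poly[OF unit z y0, of q "degree p"] q le d by (auto simp: good_def)
    define l where "l = lead_coeff p"
    define p' where "p' = p - monom l (degree p) + smult l r"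
    have "coeff p' i = 0" if "i \<ge> degree p" for i
      using that r(2) unfolding p'_def l_def by (cases "i = degree p") (auto simp: coeff_eq_0)
    then have "degree p' < degree p" using d
      by (metis degree_0 leading_coeff_0_iff not_less)
    moreover have "good y p'"
      using p r unfolding good_def p'_def l_def by (auto simp: poly_monom)
    ultimately show ?thesis by blast
  qed
  have "y \<in> D \<or> inverse y \<in> D" for y
  proof (rule ccontr)
    assume "\<not> (y \<in> D \<or> inverse y \<in> D)"
    then have y: "y \<notin> D" "inverse y \<notin> D" and y0: "y \<noteq> 0" by auto
    have least: "\<exists>p. good w p \<and> (\<forall>p'. good w p' \<longrightarrow> degree p \<le> degree p')" if "w \<notin> D" for w
      using ex_poly[OF that] ex_has_least_nat[of "good w" _ degree] unfolding good_def by blast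
    obtain p where p: "good y p" "\<And>p'. good y p' \<Longrightarrow> degree p \<le> degree p'"
      using least[OF y(1)] by blast
    obtain q where q: "good (inverse y) q" "\<And>q'. good (inverse y) q' \<Longrightarrow> degree q \<le> degree q'"
      using least[OF y(2)] by blast
    show False
    proof (cases "degree q \<le> degree p")
      case True
      then show False using reduce[OF p(1) q(1) _ y0] p(2) by force
    next
      case False
      then show False using reduce[of "inverse y" q p] p(1) q y0 by force
    qed
  qed
  then have "valuation_ring D" by unfold_locales auto
  then show ?thesis using that B z iz by blast
qed

section \<open>Divisibility in a valuation ring\<close>

text \<open>\<open>x \<in> multiples e\<close> says that the valuation of \<open>x\<close> is at least that of \<open>e\<close>. All the
  estimates below are of this form, so that no value group has to be constructed; total ordering
  of the valuations is the fact \<open>multiples_linear\<close>.\<close>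

context valuation_ring begin

definition multiples :: "'a \<Rightarrow> 'a set" where
  "multiples e = {e * c | c. c \<in> B}"

definition invertible :: "'a \<Rightarrow> bool" where
  "invertible u \<longleftrightarrow> u \<noteq> 0 \<and> u \<in> B \<and> inverse u \<in> B"

definition noninvertible :: "'a \<Rightarrow> bool" where
  "noninvertible x \<longleftrightarrow> x \<in> B \<and> \<not> invertible x"

lemma multiplesI: "x = e * c \<Longrightarrow> c \<in> B \<Longrightarrow> x \<in> multiples e"
  unfolding multiples_def by blast

lemma multiplesE: "x \<in> multiples e \<Longrightarrow> (\<And>c. x = e * c \<Longrightarrow> c \<in> B \<Longrightarrow> P) \<Longrightarrow> P"
  unfolding multiples_def by blast

lemma multiples_self: "e \<in> multiples e"
  by (rule multiplesI[of _ _ 1]) auto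

lemma multiples_zero [simp]: "0 \<in> multiples e"
  by (rule multiplesI[of _ _ 0]) auto

lemma multiples_add: "x \<in> multiples e \<Longrightarrow> y \<in> multiples e \<Longrightarrow> x + y \<in> multiples e"
  unfolding multiples_def by (clarify, metis add_closed distrib_left)

lemma multiples_uminus: "x \<in> multiples e \<Longrightarrow> - x \<in> multiples e"
  unfolding multiples_def by (clarify, metis uminus_closed mult_minus_right)

lemma multiples_diff: "x \<in> multiples e \<Longrightarrow> y \<in> multiples e \<Longrightarrow> x - y \<in> multiples e"
  using multiples_add[of x e "- y"] multiples_uminus by simp

lemma multiples_mult_right: "x \<in> multiples e \<Longrightarrow> c \<in> B \<Longrightarrow> x * c \<in> multiples e"
  unfolding multiples_def by (clarify, metis mult_closed mult.assoc)

lemma multiples_mult_left: "x \<in> multiples e \<Longrightarrow> c \<in> B \<Longrightarrow> c * x \<in> multiples e"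
  using multiples_mult_right[of x e c] by (simp add: mult.commute)

lemma multiples_sum: "(\<And>i. i \<in> I \<Longrightarrow> f i \<in> multiples e) \<Longrightarrow> sum f I \<in> multiples e"
  by (induction I rule: infinite_finite_induct) (auto intro: multiples_add)

lemma multiples_mult_mult: "x \<in> multiples e \<Longrightarrow> y \<in> multiples f \<Longrightarrow> x * y \<in> multiples (e * f)"
  by (auto elim!: multiplesE intro!: multiplesI[of _ _ "_ * _"] simp: mult_ac)

lemma multiples_power: "x \<in> multiples e \<Longrightarrow> x ^ k \<in> multiples (e ^ k)"
  by (induction k) (auto intro: multiples_mult_mult multiples_self)

lemma multiples_prod:
  "(\<And>i. i \<in> I \<Longrightarrow> f i \<in> multiples (g i)) \<Longrightarrow> prod f I \<in> multiples (prod g I)"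
  by (induction I rule: infinite_finite_induct) (auto intro: multiples_mult_mult multiples_self)

lemma multiples_trans: "x \<in> multiples y \<Longrightarrow> y \<in> multiples z \<Longrightarrow> x \<in> multiples z"
  by (metis multiplesE multiples_mult_right)

lemma multiples_subset: "e \<in> B \<Longrightarrow> x \<in> multiples e \<Longrightarrow> x \<in> B"
  by (auto elim!: multiplesE)

lemma multiples_one [simp]: "x \<in> multiples 1 \<longleftrightarrow> x \<in> B"
  unfolding multiples_def by auto

lemma multiples_cancel: "c \<noteq> 0 \<Longrightarrow> c * x \<in> multiples (c * y) \<longleftrightarrow> x \<in> multiples y"
  unfolding multiples_def by (auto simp: mult.assoc)

lemma multiples_linear: "x \<in> multiples y \<or> y \<in> multiples x"
proof (cases "x = 0 \<or> y = 0")
  case False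
  then have "x = y * (x / y)" "y = x * inverse (x / y)" by (auto simp: field_simps)
  then show ?thesis using in_or_inverse_in[of "x / y"] multiplesI by blast
qed auto

lemma invertible_or_noninvertible: "x \<in> B \<Longrightarrow> invertible x \<or> noninvertible x"
  by (auto simp: noninvertible_def)

lemma noninvertible_mult: "noninvertible x \<Longrightarrow> c \<in> B \<Longrightarrow> noninvertible (x * c)"
proof -
  assume *: "noninvertible x" "c \<in> B"
  have "\<not> invertible (x * c)"
  proof
    assume **: "invertible (x * c)"
    then have "inverse x = c * inverse (x * c)" by (auto simp: invertible_def)
    also have "\<dots> \<in> B" using * ** by (auto simp: invertible_def simp del: inverse_mult_distrib)
    finally show False using * ** unfolding noninvertible_def invertible_def by simp
  qed
  then show ?thesis using * by (auto simp: noninvertible_def)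
qed

text \<open>The noninvertible elements form the maximal ideal.\<close>

lemma noninvertible_add: "noninvertible x \<Longrightarrow> noninvertible y \<Longrightarrow> noninvertible (x + y)"
proof -
  assume *: "noninvertible x" "noninvertible y"
  from multiples_linear[of x y] show ?thesis
  proof
    assume "x \<in> multiples y"
    then obtain c where "x = y * c" "c \<in> B" by (rule multiplesE)
    then show ?thesis using noninvertible_mult[OF *(2), of "c + 1"] by (auto simp: distrib_left)
  next
    assume "y \<in> multiples x"
    then obtain c where "y = x * c" "c \<in> B" by (rule multiplesE)
    then show ?thesis using noninvertible_mult[OF *(1), of "1 + c"] by (auto simp: distrib_left)
  qed
qed

lemma noninvertible_uminus: "noninvertible x \<Longrightarrow> noninvertible (- x)"
  using noninvertible_mult[of x "- 1"] by auto

lemma noninvertible_diff: "noninvertible x \<Longrightarrow> noninvertible y \<Longrightarrow> noninvertible (x - y)"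
  using noninvertible_add[of x "- y"] noninvertible_uminus by simp

lemma invertible_add: "invertible u \<Longrightarrow> noninvertible x \<Longrightarrow> invertible (u + x)"
  using noninvertible_diff[of "u + x" x]
  by (metis add_closed add_diff_cancel_right' invertible_def noninvertible_def)

lemma invertible_mult: "invertible u \<Longrightarrow> invertible v \<Longrightarrow> invertible (u * v)"
  by (auto simp: invertible_def)

lemma invertible_of_rat: "q \<noteq> 0 \<Longrightarrow> invertible (of_rat q)"
  unfolding invertible_def by (metis of_rat_closed of_rat_eq_0_iff of_rat_inverse)

lemma invertible_numeral [simp]: "invertible (numeral k)"
  using invertible_of_rat[of "numeral k"] by simp

lemma invertible_one [simp]: "invertible 1"
  using invertible_of_rat[of 1] by simp

lemma invertible_or_complement: "a \<in> B \<Longrightarrow> invertible a \<or> invertible (1 - a)"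
  using noninvertible_add[of a "1 - a"] by (auto simp: noninvertible_def)

lemma multiples_cancel_invertible:
  assumes "invertible u" "u * x \<in> multiples e" shows "x \<in> multiples e"
proof -
  have "x = inverse u * (u * x)" using assms by (simp add: invertible_def)
  also have "\<dots> \<in> multiples e"
    by (rule multiples_mult_left[OF assms(2)]) (use assms(1) in \<open>simp add: invertible_def\<close>)
  finally show ?thesis .
qed

lemma noninvertible_multiples: "noninvertible e \<Longrightarrow> x \<in> multiples e \<Longrightarrow> noninvertible x"
  by (auto elim!: multiplesE intro: noninvertible_mult)

lemma multiples_sqrt: "x\<^sup>2 \<in> multiples (e\<^sup>2) \<Longrightarrow> x \<in> multiples e"
proof (cases "e = 0")
  case False
  assume "x\<^sup>2 \<in> multiples (e\<^sup>2)"
  then obtain c where "x\<^sup>2 = e\<^sup>2 * c" "c \<in> B" by (rule multiplesE)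
  then have "(x / e)\<^sup>2 \<in> B" using False by (simp add: power_divide)
  then have "x / e \<in> B" by (rule in_if_square_in)
  then show ?thesis using False by (intro multiplesI[of _ _ "x / e"]) auto
qed (auto elim: multiplesE)

end

section \<open>Gram matrices of nearly degenerate triangles\<close>

text \<open>Think of vectors \<open>v\<^sub>k = a k \<cdot> u + f k\<close>, with a unit vector \<open>u\<close> and \<open>f k\<close> orthogonal to \<open>u\<close>, whose
  Gram matrix is \<open>h\<close>. Up to terms divisible by a diagonal entry of \<open>h\<close>, the squared area of the
  triangle with vertices \<open>v\<^sub>i\<close>, \<open>v\<^sub>j\<close>, \<open>v\<^sub>k\<close> is \<open>- triangle_defect a h i j k / 4\<close>.\<close>

definition triangle_defect :: "('i \<Rightarrow> 'a) \<Rightarrow> ('i \<Rightarrow> 'i \<Rightarrow> 'a) \<Rightarrow> 'i \<Rightarrow> 'i \<Rightarrow> 'i \<Rightarrow> 'a::comm_ring_1" where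
  "triangle_defect a h i j k =
     2 * (a j - a i) * (a k - a i) * h j k
     + 2 * (a j - a k) * (h i k * (a j - a i) - h i j * (a k - a i))
     + (h i j - h i k)\<^sup>2 + (h j k)\<^sup>2 - 2 * h j k * (h i j + h i k)"

text \<open>A simplex with vertices \<open>0\<close>, \<open>u\<close> and \<open>v\<^sub>k = a k \<cdot> u + f k\<close>, \<open>k \<in> I\<close>, all of whose \<open>2\<close>-faces have
  a squared area divisible by \<open>e\<close>. The hypotheses \<open>h_diag\<close>, \<open>face0\<close>, \<open>face1\<close> and \<open>face\<close> come from
  the triangles \<open>0 u v\<^sub>k\<close>, \<open>0 v\<^sub>k v\<^sub>l\<close>, \<open>u v\<^sub>k v\<^sub>l\<close> and \<open>v\<^sub>i v\<^sub>j v\<^sub>k\<close>; in the last three, multiples of the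
  diagonal entries of \<open>h\<close> are discarded.\<close>

locale degenerate_triangles = valuation_ring B for B :: "'a::field_char_0 set" +
  fixes e :: 'a and I :: "'i set" and a :: "'i \<Rightarrow> 'a" and h :: "'i \<Rightarrow> 'i \<Rightarrow> 'a"
  assumes e: "noninvertible e"
    and a_in: "k \<in> I \<Longrightarrow> a k \<in> B"
    and h_in: "k \<in> I \<Longrightarrow> l \<in> I \<Longrightarrow> h k l \<in> B"
    and h_sym: "k \<in> I \<Longrightarrow> l \<in> I \<Longrightarrow> h k l = h l k"
    and h_diag: "k \<in> I \<Longrightarrow> h k k \<in> multiples e"
    and face0: "k \<in> I \<Longrightarrow> l \<in> I \<Longrightarrow> h k l * (h k l + 2 * a k * a l) \<in> multiples e"
    and face1: "k \<in> I \<Longrightarrow> l \<in> I \<Longrightarrow> h k l * (h k l + 2 * (1 - a k) * (1 - a l)) \<in> multiples e"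
    and face: "i \<in> I \<Longrightarrow> j \<in> I \<Longrightarrow> k \<in> I \<Longrightarrow> triangle_defect a h i j k \<in> multiples e"
begin

abbreviation E :: "'a set" where "E \<equiv> multiples e"

text \<open>Up to an invertible factor, this is the value of any big entry in row \<open>k\<close> of \<open>h\<close>
  (\<open>big_edge_associated\<close> below).\<close>

definition w :: "'i \<Rightarrow> 'a" where "w k = a k * (1 - a k)"

text \<open>With \<open>e = \<epsilon>\<^sup>2\<close>, the elements that are not big are those of size at most \<open>\<epsilon>\<close>. An entry of \<open>h\<close>
  is big when the tetrahedron that it spans with \<open>0\<close> and \<open>u\<close> is far from flat although its faces
  are nearly degenerate.\<close>

definition big :: "'a \<Rightarrow> bool" where "big x \<longleftrightarrow> x \<in> B \<and> x\<^sup>2 \<notin> E"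

lemma w_in [intro]: "k \<in> I \<Longrightarrow> w k \<in> B"
  unfolding w_def using a_in by auto

lemma E_sub: "x \<in> E \<Longrightarrow> x \<in> B"
  using multiples_subset e by (auto simp: noninvertible_def)

lemma E_not_big: "x \<in> E \<Longrightarrow> \<not> big x"
  unfolding big_def power2_eq_square using multiples_mult_right E_sub by blast

lemma big_nonzero: "big p \<Longrightarrow> p \<noteq> 0"
  unfolding big_def by auto

text \<open>\<open>e\<close> is a proper multiple of the square of a big element. This is what makes all error terms
  negligible in comparison with big entries.\<close>

lemma E_below_big:
  assumes "big p" "x \<in> E" shows "\<exists>\<mu>. noninvertible \<mu> \<and> x = p * p * \<mu>"
proof -
  have "p\<^sup>2 \<notin> multiples e" using assms by (simp add: big_def)
  then have "e \<in> multiples (p\<^sup>2)" using multiples_linear by blast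
  then obtain c where c: "e = p\<^sup>2 * c" "c \<in> B" by (rule multiplesE)
  have "noninvertible c"
  proof (rule ccontr)
    assume "\<not> noninvertible c"
    then have "invertible c" using c by (auto simp: noninvertible_def)
    moreover have "c * p\<^sup>2 \<in> multiples e" using c multiples_self[of e] by (simp add: mult.commute)
    ultimately have "p\<^sup>2 \<in> multiples e" by (rule multiples_cancel_invertible)
    then show False using assms by (simp add: big_def)
  qed
  obtain d where d: "x = e * d" "d \<in> B" using assms(2) by (rule multiplesE)
  have "x = p * p * (c * d)" unfolding d c by (simp add: power2_eq_square)
  then show ?thesis using noninvertible_mult[OF \<open>noninvertible c\<close> d(2)] by blast
qed

lemma below_big:
  assumes "big p" "p * x \<in> E" shows "\<exists>\<mu>. noninvertible \<mu> \<and> x = p * \<mu>"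
  using E_below_big[OF assms] big_nonzero[OF assms(1)] by auto

lemma below_big': 
  assumes "big p" "p * x \<in> E" shows "x \<in> multiples p" "noninvertible x"
proof -
  obtain \<mu> where \<mu>: "noninvertible \<mu>" "x = p * \<mu>" using below_big[OF assms] by blast
  then show "x \<in> multiples p" by (auto intro: multiplesI simp: noninvertible_def)
  show "noninvertible x" using noninvertible_mult[OF \<mu>(1), of p] \<mu> assms
    by (simp add: big_def mult.commute)
qed

lemma not_big_below_big:
  assumes "big p" "x \<in> B" "\<not> big x" shows "x \<in> multiples p"
proof (rule ccontr)
  assume "x \<notin> multiples p"
  then have "p \<in> multiples x" using multiples_linear by blast
  then have "p\<^sup>2 \<in> multiples (x\<^sup>2)" using multiples_power by blast
  then have "p\<^sup>2 \<in> E" using assms multiples_trans by (auto simp: big_def)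
  then show False using assms by (simp add: big_def)
qed

lemma mult_not_big:
  assumes "x \<in> B" "y \<in> B" "\<not> big x" "\<not> big y" shows "x * y \<in> E"
proof -
  have sq: "x * x \<in> E" "y * y \<in> E" using assms by (auto simp: big_def power2_eq_square)
  from multiples_linear[of x y] show ?thesis
  proof
    assume "x \<in> multiples y"
    then obtain c where "x = y * c" "c \<in> B" by (rule multiplesE)
    then show ?thesis using sq(2) multiples_mult_right[of "y * y" e c] by (simp add: mult_ac)
  next
    assume "y \<in> multiples x"
    then obtain c where "y = x * c" "c \<in> B" by (rule multiplesE)
    then show ?thesis using sq(1) multiples_mult_right[of "x * x" e c] by (simp add: mult_ac)
  qed
qed

lemma mult_big:
  assumes "big x" "big y" shows "x * y \<notin> E"
proof
  assume xy: "x * y \<in> E"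
  from multiples_linear[of x y] show False
  proof
    assume "x \<in> multiples y"
    then obtain c where "x = y * c" "c \<in> B" by (rule multiplesE)
    then have "x\<^sup>2 \<in> E" using xy multiples_mult_right[of "x * y" e c]
      by (simp add: mult_ac power2_eq_square)
    then show False using assms by (simp add: big_def)
  next
    assume "y \<in> multiples x"
    then obtain c where "y = x * c" "c \<in> B" by (rule multiplesE)
    then have "y\<^sup>2 \<in> E" using xy multiples_mult_right[of "x * y" e c]
      by (simp add: mult_ac power2_eq_square)
    then show False using assms by (simp add: big_def)
  qed
qed

lemma multiple_mult_E:
  assumes "x \<in> multiples p" "p * y \<in> E" shows "x * y \<in> E"
  using assms(1)
proof (rule multiplesE)
  fix c assume "x = p * c" "c \<in> B"
  then show ?thesis using multiples_mult_right[OF assms(2), of c] by (simp add: mult_ac)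
qed

lemma two_cancel: "2 * x \<in> E \<Longrightarrow> x \<in> E"
  using multiples_cancel_invertible[of 2 x e] by simp

text \<open>The difference of \<open>face0\<close> and \<open>face1\<close> is \<open>2 p (a\<^sub>i + a\<^sub>j - 1)\<close> for \<open>p = h i j\<close>. So the two vertices
  of a big entry lie nearly symmetrically with respect to the midpoint of the edge \<open>0 u\<close>: in the
  limit the tetrahedron has equal opposite edges.\<close>

lemma big_edge_coordinates:
  assumes "i \<in> I" "j \<in> I" "big (h i j)"
  shows "h i j * (a j - (1 - a i)) \<in> E" "h i j * (h i j + 2 * w i) \<in> E"
proof -
  let ?p = "h i j"
  have "?p * (?p + 2 * a i * a j) - ?p * (?p + 2 * (1 - a i) * (1 - a j)) \<in> E"
    using face0 face1 assms by (intro multiples_diff) auto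
  also have "?p * (?p + 2 * a i * a j) - ?p * (?p + 2 * (1 - a i) * (1 - a j)) = 2 * (?p * (a j - (1 - a i)))"
    by (simp add: algebra_simps)
  finally show 1: "?p * (a j - (1 - a i)) \<in> E" by (rule two_cancel)
  have "?p * (?p + 2 * a i * a j) - (2 * a i) * (?p * (a j - (1 - a i))) \<in> E"
    using face0 assms a_in by (intro multiples_diff multiples_mult_left[OF 1]) auto
  also have "?p * (?p + 2 * a i * a j) - (2 * a i) * (?p * (a j - (1 - a i))) = ?p * (?p + 2 * w i)"
    by (simp add: w_def algebra_simps)
  finally show "?p * (?p + 2 * w i) \<in> E" .
qed

lemma big_edge_associated:
  assumes "i \<in> I" "j \<in> I" "big (h i j)"
  shows "w i \<in> multiples (h i j)" "h i j \<in> multiples (w i)"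
proof -
  let ?p = "h i j"
  obtain \<mu> where \<mu>: "noninvertible \<mu>" "?p + 2 * w i = ?p * \<mu>"
    using below_big[OF assms(3) big_edge_coordinates(2)[OF assms]] by blast
  have w: "2 * w i = ?p * (\<mu> - 1)" using \<mu>(2) by (simp add: algebra_simps)
  have inv: "invertible (\<mu> - 1)" 
    using invertible_add[of "-1" \<mu>] \<mu>(1) invertible_of_rat[of "-1"] by simp
  have "2 * w i \<in> multiples ?p" using w inv by (intro multiplesI) (auto simp: invertible_def)
  then show "w i \<in> multiples ?p" using multiples_cancel_invertible[of 2] by simp
  have "(\<mu> - 1) * ?p \<in> multiples (w i)"
    by (rule multiplesI[of _ _ 2]) (use w in \<open>auto simp: algebra_simps\<close>)
  then show "?p \<in> multiples (w i)" using inv multiples_cancel_invertible by blast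
qed

lemma big_edge_scale:
  assumes "i \<in> I" "j \<in> I" "big (h i j)"
  shows "h i j * x \<in> E \<longleftrightarrow> w i * x \<in> E"
  using big_edge_associated[OF assms] multiples_self multiple_mult_E by blast

lemma big_edges_comparable:
  assumes "i \<in> I" "j \<in> I" "k \<in> I" "big (h i j)" "big (h i k)"
  shows "h i j \<in> multiples (h i k)" "h i k \<in> multiples (h i j)"
  using big_edge_associated[OF assms(1,2,4)] big_edge_associated[OF assms(1,3,5)] multiples_trans
  by blast+

text \<open>Two vertices that both form a big entry with \<open>i\<close> are close to each other. By
  \<open>big_edge_coordinates\<close> they have the same coordinate along \<open>u\<close> and the same entry with \<open>i\<close>, up
  to error terms. The face \<open>i j k\<close> then leaves two possibilities for \<open>r = h j k\<close>: either it is
  small, or it is close to \<open>-2\<close>. The second one contradicts the faces at \<open>0\<close> and \<open>u\<close>.\<close>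

lemma fork:
  assumes I: "i \<in> I" "j \<in> I" "k \<in> I" and big: "big (h i j)" "big (h i k)"
  shows "h i j * (h i k - h i j) \<in> E" "h i j * (a k - a j) \<in> E" "h j k \<in> E"
proof -
  define p q r where "p = h i j" "q = h i k" "r = h j k"
  have bp: "big p" and bq: "big q" using big by (simp_all add: p_q_r_def)
  have [simp, intro]: "p \<in> B" "q \<in> B" "r \<in> B" "a i \<in> B" "a j \<in> B" "a k \<in> B" "w i \<in> B"
    using I h_in a_in by (auto simp: p_q_r_def)
  have pq: "p \<in> multiples q" "q \<in> multiples p"
    using big_edges_comparable[OF I big] by (simp_all add: p_q_r_def)
  have pj: "p * (a j - (1 - a i)) \<in> E" "p * (p + 2 * w i) \<in> E"
    using big_edge_coordinates[OF I(1,2) big(1)] by (simp_all add: p_q_r_def)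
  have qk: "q * (a k - (1 - a i)) \<in> E" "q * (q + 2 * w i) \<in> E"
    using big_edge_coordinates[OF I(1,3) big(2)] by (simp_all add: p_q_r_def)
  have pk: "p * (a k - (1 - a i)) \<in> E" "p * (q + 2 * w i) \<in> E"
    using multiple_mult_E[OF pq(1) qk(1)] multiple_mult_E[OF pq(1) qk(2)] by auto
  have "p * (q + 2 * w i) - p * (p + 2 * w i) \<in> E" using pk pj by (intro multiples_diff)
  then have d: "p * (q - p) \<in> E" by (simp add: algebra_simps)
  then show "h i j * (h i k - h i j) \<in> E" by (simp add: p_q_r_def)
  have "p * (a k - (1 - a i)) - p * (a j - (1 - a i)) \<in> E" using pk pj by (intro multiples_diff)
  then have akj: "p * (a k - a j) \<in> E" by (simp add: algebra_simps)
  then show "h i j * (a k - a j) \<in> E" by (simp add: p_q_r_def)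
  \<comment> \<open>The face \<open>i j k\<close> says that \<open>r f\<close> is negligible, where \<open>f\<close> turns out to be close to
    \<open>2 + r\<close>.\<close>
  define D where "D = triangle_defect a h i j k"
  have DE: "D \<in> E" unfolding D_def using face I by blast
  have ajk: "p * (a j - a k) \<in> E" using multiples_uminus[OF akj] by (simp add: algebra_simps)
  define f where "f = 2 * (a j - a i) * (a k - a i) + r - 2 * (p + q)"
  have "r * f = D - 2 * (q * (a j - a k)) * (a j - a i) + 2 * (p * (a j - a k)) * (a k - a i) - (p - q) * (p - q)"
    unfolding D_def f_def triangle_defect_def p_q_r_def[symmetric]
    by (simp add: algebra_simps power2_eq_square)
  also have "\<dots> \<in> E"
  proof -
    have "2 * (q * (a j - a k)) * (a j - a i) \<in> E"
      by (intro multiples_mult_right multiples_mult_left multiple_mult_E[OF pq(2) ajk]) auto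
    moreover have "2 * (p * (a j - a k)) * (a k - a i) \<in> E"
      by (intro multiples_mult_right multiples_mult_left ajk) auto
    moreover have "(p - q) * (p - q) \<in> E"
    proof (rule multiple_mult_E)
      show "p - q \<in> multiples p" using pq by (intro multiples_diff multiples_self)
      show "p * (p - q) \<in> E" using multiples_uminus[OF d] by (simp add: algebra_simps)
    qed
    ultimately show ?thesis using DE by (intro multiples_diff multiples_add)
  qed
  finally have rf: "r * f \<in> E" .
  define \<delta> \<eta> where "\<delta> = a j - (1 - a i)" "\<eta> = a k - (1 - a i)"
  have n1: "noninvertible \<delta>" "noninvertible \<eta>" "noninvertible (p + 2 * w i)" "noninvertible (q + 2 * w i)"
    using below_big'(2)[OF bp pj(1)] below_big'(2)[OF bp pk(1)] below_big'(2)[OF bp pj(2)]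
      below_big'(2)[OF bp pk(2)] by (simp_all add: \<delta>_\<eta>_def)
  have dB: "\<delta> \<in> B" "\<eta> \<in> B" by (auto simp: \<delta>_\<eta>_def)
  define \<mu> where "\<mu> = \<delta> * (2 * (1 - 2 * a i)) + \<eta> * (2 * (1 - 2 * a i + \<delta>))
      - (p + 2 * w i) * 2 - (q + 2 * w i) * 2"
  have \<mu>: "noninvertible \<mu>"
    unfolding \<mu>_def using dB
    by (intro n1 noninvertible_diff noninvertible_mult noninvertible_add) auto
  have f: "f = 2 + r + \<mu>"
    unfolding f_def \<mu>_def \<delta>_\<eta>_def w_def by (simp add: algebra_simps)
  have "r \<in> E"
  proof (cases "noninvertible r")
    case True
    have "invertible f" unfolding f add.assoc using True \<mu>
      by (intro invertible_add noninvertible_add) auto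
    moreover have "f * r \<in> E" using rf by (simp add: mult.commute)
    ultimately show ?thesis by (rule multiples_cancel_invertible)
  next
    case False
    then have inv: "invertible r" using invertible_or_noninvertible by auto
    have nE: "x \<in> E \<Longrightarrow> noninvertible x" for x using noninvertible_multiples[OF e] .
    have "f \<in> E" using multiples_cancel_invertible[OF inv rf] .
    then have nf: "noninvertible f" using nE by auto
    have "r + 2 * a j * a k \<in> E" "r + 2 * (1 - a j) * (1 - a k) \<in> E"
      using multiples_cancel_invertible[OF inv] face0[OF I(2,3)] face1[OF I(2,3)]
      by (simp_all add: p_q_r_def)
    then have n2: "noninvertible (r + 2 * a j * a k)" "noninvertible (r + 2 * (1 - a j) * (1 - a k))"
      using nE by auto
    \<comment> \<open>Modulo noninvertible elements \<open>r = -2\<close>, so the faces at \<open>0\<close> and \<open>u\<close> give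
      \<open>(1 - a\<^sub>i)\<^sup>2 = 1\<close> and \<open>a\<^sub>i\<^sup>2 = 1\<close>, which is impossible.\<close>
    define X where "X = 1 - a i * a i"
    define Y where "Y = 1 - (1 - a i) * (1 - a i)"
    have "2 * X = f - \<mu> - (r + 2 * (1 - a j) * (1 - a k)) - \<delta> * (2 * a i) + \<eta> * (2 * (\<delta> - a i))"
      unfolding X_def f \<delta>_\<eta>_def by (simp add: algebra_simps)
    also have "noninvertible \<dots>"
      using dB by (intro nf \<mu> n1 n2 noninvertible_diff noninvertible_add noninvertible_mult) auto
    finally have nX: "noninvertible (2 * X)" .
    have "2 * Y = f - \<mu> - (r + 2 * a j * a k) + \<delta> * (2 * (1 - a i)) + \<eta> * (2 * (1 - a i + \<delta>))"
      unfolding Y_def f \<delta>_\<eta>_def by (simp add: algebra_simps)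
    also have "noninvertible \<dots>"
      using dB by (intro nf \<mu> n1 n2 noninvertible_diff noninvertible_add noninvertible_mult) auto
    finally have nY: "noninvertible (2 * Y)" .
    \<comment> \<open>Eliminating \<open>a\<^sub>i\<close> between \<open>a\<^sub>i\<^sup>2 = 1\<close> and \<open>(1 - a\<^sub>i)\<^sup>2 = 1\<close> leaves \<open>6 = 0\<close>.\<close>
    have "6 = 2 * X * 4 + (2 * Y - 2 * X) * (2 * a i + 1)"
      unfolding X_def Y_def by (simp add: algebra_simps)
    also have "noninvertible \<dots>"
      by (intro nX nY noninvertible_diff noninvertible_add noninvertible_mult) auto
    finally show ?thesis using invertible_numeral by (simp add: noninvertible_def)
  qed
  then show "h j k \<in> E" by (simp add: p_q_r_def)
qed

lemma small_edge:
  assumes I: "k \<in> I" "l \<in> I" and small: "\<not> big (h k l)"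
  shows "h k l * a k * a l \<in> E" "h k l * (1 - a k) * (1 - a l) \<in> E"
proof -
  have small_times: "h k l * x \<in> E" if "h k l * (h k l + 2 * x) \<in> E" for x
  proof -
    have "h k l * (h k l + 2 * x) - h k l * h k l \<in> E"
      using h_in[OF I] small by (intro multiples_diff[OF that] mult_not_big)
    also have "h k l * (h k l + 2 * x) - h k l * h k l = 2 * (h k l * x)"
      by (simp add: algebra_simps)
    finally show ?thesis by (rule two_cancel)
  qed
  show "h k l * a k * a l \<in> E"
    using small_times[of "a k * a l"] face0[OF I] by (simp only: mult.assoc simp_thms)
  show "h k l * (1 - a k) * (1 - a l) \<in> E"
    using small_times[of "(1 - a k) * (1 - a l)"] face1[OF I] by (simp only: mult.assoc simp_thms)
qed

text \<open>A vertex \<open>k\<close> that forms no big entry with the two vertices of a big entry \<open>p = h i j\<close> is close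
  to \<open>0\<close> or to \<open>u\<close>: the terms of the face \<open>i j k\<close> that involve \<open>h i k\<close> and \<open>h j k\<close> are negligible
  because of the faces at \<open>0\<close> and \<open>u\<close>, and the remaining ones add up to \<open>- 2 p \<cdot> w k\<close>.\<close>

lemma isolated:
  assumes I: "i \<in> I" "j \<in> I" "k \<in> I"
    and big: "big (h i j)" and small: "\<not> big (h i k)" "\<not> big (h j k)"
  shows "h i j * h i k \<in> E" "h i j * h j k \<in> E" "h i j * w k \<in> E"
proof -
  define p q r where "p = h i j" "q = h i k" "r = h j k"
  have bp: "big p" and nq: "\<not> big q" and nr: "\<not> big r" using big small by (simp_all add: p_q_r_def)
  have [simp, intro]: "p \<in> B" "q \<in> B" "r \<in> B" "a i \<in> B" "a j \<in> B" "a k \<in> B" "w i \<in> B"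
    using I h_in a_in by (auto simp: p_q_r_def)
  have q0: "q * a i * a k \<in> E" and q1: "q * (1 - a i) * (1 - a k) \<in> E"
    and r0: "r * a j * a k \<in> E" and r1: "r * (1 - a j) * (1 - a k) \<in> E"
    unfolding p_q_r_def using small_edge I small by blast+
  have "w i * q = q * a i * a k * (1 - a i) + q * (1 - a i) * (1 - a k) * a i"
    by (simp add: w_def algebra_simps)
  also have "\<dots> \<in> E" by (intro multiples_add multiples_mult_right q0 q1) auto
  finally have pq: "p * q \<in> E" using big_edge_scale[OF I(1,2) big] by (simp add: p_q_r_def)
  have "w j * r = r * a j * a k * (1 - a j) + r * (1 - a j) * (1 - a k) * a j"
    by (simp add: w_def algebra_simps)
  also have "\<dots> \<in> E" by (intro multiples_add multiples_mult_right r0 r1) auto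
  finally have pr: "p * r \<in> E" 
    using big_edge_scale[OF I(2,1)] big h_sym[OF I(1,2)] by (simp add: p_q_r_def)
  show "h i j * h i k \<in> E" "h i j * h j k \<in> E" using pq pr by (simp_all add: p_q_r_def)
  define \<delta> where "\<delta> = a j - (1 - a i)"
  have pd: "p * \<delta> \<in> E" and pw: "p * (p + 2 * w i) \<in> E"
    using big_edge_coordinates[OF I(1,2) big] by (simp_all add: p_q_r_def \<delta>_def)
  have \<delta>p: "\<delta> \<in> multiples p" using below_big'(1)[OF bp pd] .
  have \<delta>q: "\<delta> * q \<in> E" and \<delta>r: "\<delta> * r \<in> E" using multiple_mult_E[OF \<delta>p] pq pr by auto
  have [simp, intro]: "\<delta> \<in> B" by (auto simp: \<delta>_def)
  have rk: "r * (a k - a i) \<in> E"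
  proof -
    have "r * (a k - a i) = r * a j * a k - r * (1 - a j) * (1 - a k) - \<delta> * r"
      by (simp add: \<delta>_def algebra_simps)
    also have "\<dots> \<in> E" by (intro multiples_add multiples_diff \<delta>r r0 r1)
    finally show ?thesis .
  qed
  have qk: "q * (a j - a k) \<in> E"
  proof -
    have "q * (a j - a k) = q * (1 - a i) * (1 - a k) - q * a i * a k + \<delta> * q"
      by (simp add: \<delta>_def algebra_simps)
    also have "\<dots> \<in> E" by (intro multiples_add multiples_diff \<delta>q q0 q1)
    finally show ?thesis .
  qed
  have DE: "triangle_defect a h i j k \<in> E" using face I by blast
  \<comment> \<open>\<open>p\<close> is traded for \<open>- 2 \<cdot> w i\<close> and \<open>a j\<close> for \<open>1 - a i\<close>; every summand on the right is
    negligible.\<close>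
  have "2 * (p * w k) = - triangle_defect a h i j k + 2 * (a j - a i) * (r * (a k - a i))
     + 2 * (a j - a i) * (q * (a j - a k)) - 2 * (p * q) + q * q + r * r - 2 * (p * r) - 2 * (r * q)
     + (p * (p + 2 * w i)) - 2 * (p * \<delta>) * (a k - a i)"
    unfolding triangle_defect_def p_q_r_def[symmetric] \<delta>_def w_def
    by (simp add: algebra_simps power2_eq_square)
  also have "\<dots> \<in> E"
    by (intro multiples_add multiples_diff multiples_uminus DE multiples_mult_left[OF rk] pw
        multiples_mult_left[OF qk] multiples_mult_left[OF pq] multiples_mult_left[OF pr]
        mult_not_big multiples_mult_right[OF multiples_mult_left[OF pd]]
        multiples_mult_left[OF mult_not_big[OF _ _ nr nq]] nq nr) auto
  finally have "p * w k \<in> E" by (rule two_cancel)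
  then show "h i j * w k \<in> E" by (simp add: p_q_r_def)
qed

end

context degenerate_triangles begin

text \<open>\<open>cross i j k l / h i j\<close> is the inner product of the components of \<open>f k\<close> and \<open>f l\<close> orthogonal to
  \<open>f i\<close> and \<open>f j\<close>, if \<open>f i\<close> and \<open>f j\<close> are regarded as isotropic.\<close>

definition cross :: "'i \<Rightarrow> 'i \<Rightarrow> 'i \<Rightarrow> 'i \<Rightarrow> 'a" where
  "cross i j k l = h i j * h k l - h i k * h j l - h j k * h i l"

lemma leg_below_big:
  assumes I: "i \<in> I" "j \<in> I" "k \<in> I" and big: "big (h i j)"
  shows "h i k \<in> multiples (h i j)"
proof (cases "big (h i k)")
  case True
  then show ?thesis using big_edges_comparable[OF I(1,2,3) big] by blast
next
  case False
  then show ?thesis using not_big_below_big[OF big] h_in I by blast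
qed

lemma cross_fork_fork:
  assumes I: "i \<in> I" "j \<in> I" "k \<in> I" "l \<in> I"
    and big: "big (h i j)" "big (h i k)" "big (h i l)"
  shows "cross i j k l \<in> E"
  unfolding cross_def
  by (intro multiples_diff multiples_mult_left[OF fork(3)[OF I(1,3,4)]]
      multiples_mult_left[OF fork(3)[OF I(1,2,4)]] multiples_mult_right[OF fork(3)[OF I(1,2,3)]])
    (use big h_in I in auto)

text \<open>Here \<open>k\<close> is close to \<open>j\<close> and \<open>l\<close> is close to \<open>i\<close>. The entry \<open>h k l\<close> has to be big as well, as
  otherwise \<open>l\<close> would be close to \<open>0\<close> or \<open>u\<close> by \<open>isolated\<close>, applied to the big entry \<open>h i k\<close>; so all
  the entries \<open>h i k\<close>, \<open>h j l\<close>, \<open>h k l\<close> agree with \<open>h i j\<close> up to error terms.\<close>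

lemma cross_fork_opposite:
  assumes I: "i \<in> I" "j \<in> I" "k \<in> I" "l \<in> I"
    and big: "big (h i j)" "big (h i k)" "big (h j l)"
  shows "cross i j k l \<in> E"
proof -
  have ji: "h j i = h i j" "h k i = h i k" "h l j = h j l" "h l k = h k l" using h_sym I by auto
  have rk: "h j k \<in> E" using fork(3)[OF I(1,2,3) big(1,2)] .
  have fj: "h i j * (h j l - h i j) \<in> E" "h i l \<in> E"
    using fork(1,3)[OF I(2,1,4)] big ji by auto
  have bkl: "big (h k l)"
  proof (rule ccontr)
    assume small: "\<not> big (h k l)"
    have "h i k * w l \<in> E"
      using isolated(3)[OF I(1,3,4) big(2) E_not_big[OF fj(2)] small] .
    then have "h l j * h i k \<in> E"
      using big_edge_scale[OF I(4,2)] big ji by (simp add: mult.commute)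
    then show False using mult_big big ji by simp
  qed
  have "h k i * (h k l - h k i) \<in> E"
    using fork(1)[OF I(3,1,4)] big bkl ji by simp
  then have "h i j * (h k l - h i k) \<in> E"
    using multiple_mult_E[of "h i j" "h i k"] big_edges_comparable[OF I(1,2,3)] big ji by simp
  moreover have "h i k * (h j l - h i j) \<in> E"
    using multiple_mult_E[OF _ fj(1)] leg_below_big[OF I(1,2,3)] big by blast
  moreover have "h j k * h i l \<in> E" using rk fj h_in I by (intro multiples_mult_left) auto
  moreover have "cross i j k l = h i j * (h k l - h i k) - h i k * (h j l - h i j) - h j k * h i l"
    unfolding cross_def by (simp add: algebra_simps)
  ultimately show ?thesis by (simp add: multiples_diff)
qed

lemma cross_fork_isolated:
  assumes I: "i \<in> I" "j \<in> I" "k \<in> I" "l \<in> I"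
    and big: "big (h i j)" "big (h i k)" and small: "\<not> big (h i l)" "\<not> big (h j l)"
  shows "cross i j k l \<in> E"
proof -
  have ji: "h k i = h i k" "h l k = h k l" using h_sym I by auto
  have iso: "h i j * h j l \<in> E" "h i j * w l \<in> E"
    using isolated[OF I(1,2,4)] big small by auto
  have small_kl: "\<not> big (h k l)"
  proof
    assume b: "big (h k l)"
    then have "h l k * h i j \<in> E"
      using big_edge_scale[OF I(4,3)] iso(2) ji by (simp add: mult.commute)
    then show False using mult_big b big ji by simp
  qed
  have "h i k * h k l \<in> E" using isolated(2)[OF I(1,3,4) big(2) small(1) small_kl] .
  then have "h i j * h k l \<in> E"
    using multiple_mult_E big_edges_comparable[OF I(1,2,3)] big by blast
  moreover have "h i k * h j l \<in> E"
    using multiple_mult_E[OF _ iso(1)] leg_below_big[OF I(1,2,3)] big by blast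
  moreover have "h j k * h i l \<in> E"
    using fork(3)[OF I(1,2,3) big] h_in I by (intro multiples_mult_right) auto
  ultimately show ?thesis unfolding cross_def by (intro multiples_diff)
qed

text \<open>The coordinates say that \<open>k\<close> is close to \<open>u\<close> and \<open>l\<close> is close to \<open>0\<close>. This is the only position
  in which the faces at \<open>0\<close> and \<open>u\<close> do not bound \<open>h k l\<close>; the face \<open>i k l\<close> does, its coefficient at
  \<open>h k l\<close> being close to \<open>- 2 \<cdot> w i\<close>.\<close>

lemma isolated_pair:
  assumes I: "i \<in> I" "j \<in> I" "k \<in> I" "l \<in> I" and big: "big (h i j)"
    and small: "\<not> big (h i k)" "\<not> big (h j k)" "\<not> big (h i l)" "\<not> big (h j l)" "\<not> big (h k l)"
    and inv: "invertible (a k)" "invertible (1 - a l)"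
  shows "h i j * h k l \<in> E"
proof -
  define p qk ql t where "p = h i j" "qk = h i k" "ql = h i l" "t = h k l"
  have [simp, intro]: "p \<in> B" "qk \<in> B" "ql \<in> B" "t \<in> B" "a i \<in> B" "a k \<in> B" "a l \<in> B"
    using h_in a_in I by (auto simp: p_qk_ql_t_def)
  have sm: "\<not> big qk" "\<not> big ql" "\<not> big t" using small by (simp_all add: p_qk_ql_t_def)
  have below: "qk \<in> multiples p" "ql \<in> multiples p" "t \<in> multiples p"
    using leg_below_big[OF I(1,2)] I not_big_below_big[OF big] big sm
    by (auto simp: p_qk_ql_t_def h_in)
  have "a k * (p * (1 - a k)) \<in> E"
    using isolated(3)[OF I(1,2,3)] big small by (simp add: p_qk_ql_t_def w_def mult_ac)
  then have pk: "p * (1 - a k) \<in> E" using multiples_cancel_invertible inv by blast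
  have "(1 - a l) * (p * a l) \<in> E"
    using isolated(3)[OF I(1,2,4)] big small by (simp add: p_qk_ql_t_def w_def mult_ac)
  then have pl: "p * a l \<in> E" using multiples_cancel_invertible inv by blast
  have "a k * (qk * a i) \<in> E" using small_edge(1)[OF I(1,3)] small
    by (simp add: p_qk_ql_t_def mult_ac)
  then have qki: "qk * a i \<in> E" using multiples_cancel_invertible inv by blast
  have "(1 - a l) * (ql * (1 - a i)) \<in> E" using small_edge(2)[OF I(1,4)] small
    by (simp add: p_qk_ql_t_def mult_ac)
  then have qli: "ql * (1 - a i) \<in> E" using multiples_cancel_invertible inv by blast
  note E = pk pl qki qli multiple_mult_E[OF below(1) pl] multiple_mult_E[OF below(2) pk]
    multiple_mult_E[OF below(3) pl] multiple_mult_E[OF below(3) pk]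
  have D: "triangle_defect a h i k l \<in> E" using face I by blast
  have "2 * (w i * t) = - triangle_defect a h i k l + (t * a l) * (2 * (1 - a i))
      - (t * (1 - a k)) * (2 * (a l - a i))
      + (ql * (1 - a i) - ql * (1 - a k) - qk * a l + qk * a i) * (2 * (a k - a l))
      + qk * qk - (qk * ql) * 2 + ql * ql + t * t - (t * qk) * 2 - (t * ql) * 2"
    unfolding triangle_defect_def p_qk_ql_t_def[symmetric] w_def
    by (simp add: algebra_simps power2_eq_square)
  also have "\<dots> \<in> E"
    by (intro E D multiples_uminus multiples_add multiples_diff mult_not_big[OF _ _ sm(1) sm(1)]
        mult_not_big[OF _ _ sm(2) sm(2)] mult_not_big[OF _ _ sm(3) sm(3)]
        mult_not_big[OF _ _ sm(1) sm(2)] mult_not_big[OF _ _ sm(3) sm(1)]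
        mult_not_big[OF _ _ sm(3) sm(2)] multiples_mult_right) auto
  finally have "w i * t \<in> E" by (rule two_cancel)
  then show ?thesis using big_edge_scale[OF I(1,2) big] by (simp add: p_qk_ql_t_def)
qed

lemma cancel_two_invertible:
  assumes "invertible u" "invertible v" "x * u * v \<in> E" shows "x \<in> E"
proof -
  have "(u * v) * x \<in> E" using assms(3) by (simp add: mult_ac)
  then show ?thesis using multiples_cancel_invertible invertible_mult assms by blast
qed

lemma cross_isolated_isolated:
  assumes I: "i \<in> I" "j \<in> I" "k \<in> I" "l \<in> I" and big: "big (h i j)"
    and small: "\<not> big (h i k)" "\<not> big (h j k)" "\<not> big (h i l)" "\<not> big (h j l)"
  shows "cross i j k l \<in> E"
proof -
  have lk: "h l k = h k l" using h_sym I by auto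
  have isok: "h i j * h i k \<in> E" "h i j * h j k \<in> E" "h i j * w k \<in> E"
    using isolated[OF I(1,2,3)] big small by auto
  have isol: "h i j * h i l \<in> E" "h i j * h j l \<in> E"
    using isolated[OF I(1,2,4)] big small by auto
  have small_kl: "\<not> big (h k l)"
  proof
    assume b: "big (h k l)"
    then have "h k l * h i j \<in> E"
      using big_edge_scale[OF I(3,4) b] isok(3) by (simp add: mult.commute)
    then show False using mult_big b big by simp
  qed
  have "h i j * h k l \<in> E"
  proof -
    note kl = cancel_two_invertible[OF _ _ small_edge(1)[OF I(3,4) small_kl]]
    note kl' = cancel_two_invertible[OF _ _ small_edge(2)[OF I(3,4) small_kl]]
    have "invertible (a k) \<or> invertible (1 - a k)" "invertible (a l) \<or> invertible (1 - a l)"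
      using invertible_or_complement a_in I by auto
    then consider "h k l \<in> E" | "invertible (a k)" "invertible (1 - a l)"
      | "invertible (a l)" "invertible (1 - a k)" using kl kl' by blast
    then show ?thesis
    proof cases
      case 1 then show ?thesis using h_in I by (intro multiples_mult_left) auto
    next
      case 2 then show ?thesis using isolated_pair[OF I big] small small_kl by blast
    next
      case 3 then show ?thesis using isolated_pair[OF I(1,2,4,3) big] small small_kl lk by simp
    qed
  qed
  moreover have "h i k * h j l \<in> E" "h j k * h i l \<in> E"
  proof -
    have "h i k \<in> multiples (h i j)" "h i l \<in> multiples (h i j)"
      using leg_below_big I big by blast+
    then show "h i k * h j l \<in> E" "h j k * h i l \<in> E"
      using multiple_mult_E isol(2) isok(2) by (auto simp: mult.commute)
  qed
  ultimately show ?thesis unfolding cross_def by (intro multiples_diff)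
qed

lemma cross_swap:
  assumes "i \<in> I" "j \<in> I" "k \<in> I" "l \<in> I"
  shows "cross j i k l = cross i j k l" "cross i j l k = cross i j k l"
  using assms unfolding cross_def by (auto simp: h_sym algebra_simps)

text \<open>Splitting off the plane of a big entry \<open>p\<close> leaves vectors whose inner products are of size
  \<open>\<epsilon>\<^sup>2 / p\<close>. Each of \<open>k\<close> and \<open>l\<close> is close to \<open>j\<close> (big entry with \<open>i\<close>), to \<open>i\<close> (big entry with \<open>j\<close>),
  or to an end of the edge \<open>0 u\<close> (neither); the nine cases are reduced to four by symmetry.\<close>

theorem cross_in:
  assumes I: "i \<in> I" "j \<in> I" "k \<in> I" "l \<in> I" and big: "big (h i j)"
  shows "cross i j k l \<in> E"
proof -
  have big': "big (h j i)" using big h_sym I by simp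
  have excl: "\<not> big (h j m)" if "m \<in> I" "big (h i m)" for m
    using fork(3)[OF I(1,2) that(1) big that(2)] E_not_big by blast
  consider (II) "big (h i k)" "big (h i l)" | (IJ) "big (h i k)" "big (h j l)"
    | (JI) "big (h j k)" "big (h i l)" | (JJ) "big (h j k)" "big (h j l)"
    | (I0) "big (h i k)" "\<not> big (h i l)" "\<not> big (h j l)"
    | (J0) "big (h j k)" "\<not> big (h i l)" "\<not> big (h j l)"
    | (OI) "big (h i l)" "\<not> big (h i k)" "\<not> big (h j k)"
    | (OJ) "big (h j l)" "\<not> big (h i k)" "\<not> big (h j k)"
    | (OO) "\<not> big (h i k)" "\<not> big (h j k)" "\<not> big (h i l)" "\<not> big (h j l)"
    by blast
  then show ?thesis
  proof cases
    case II then show ?thesis using cross_fork_fork I big by blast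
  next
    case IJ then show ?thesis using cross_fork_opposite I big by blast
  next
    case JI then show ?thesis using cross_fork_opposite[OF I(2,1,3,4) big'] cross_swap[OF I] by simp
  next
    case JJ then show ?thesis using cross_fork_fork[OF I(2,1,3,4) big'] cross_swap[OF I] by simp
  next
    case I0 then show ?thesis using cross_fork_isolated[OF I big] by blast
  next
    case J0 then show ?thesis using cross_fork_isolated[OF I(2,1,3,4) big'] cross_swap[OF I] by simp
  next
    case OI then show ?thesis using cross_fork_isolated[OF I(1,2,4,3) big] cross_swap[OF I] by simp
  next
    case OJ
    then show ?thesis using cross_fork_isolated[OF I(2,1,4,3) big'] 
        cross_swap(1)[OF I(1,2,4,3)] cross_swap(2)[OF I] by simp
  next
    case OO then show ?thesis using cross_isolated_isolated[OF I big] by blast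
  qed
qed

text \<open>Call two vertices of the same colour if their coordinates are both invertible or both not.
  Then one of the factors \<open>2 a\<^sub>k a\<^sub>l\<close>, \<open>2 (1 - a\<^sub>k) (1 - a\<^sub>l)\<close> from the faces at \<open>0\<close> and \<open>u\<close> is
  invertible.\<close>

lemma same_colour_small:
  assumes "k \<in> I" "l \<in> I" "\<not> big (h k l)" "invertible (a k) \<longleftrightarrow> invertible (a l)"
  shows "h k l \<in> E"
proof (cases "invertible (a k)")
  case True
  then show ?thesis using cancel_two_invertible[OF _ _ small_edge(1)[OF assms(1-3)]] assms(4) by blast
next
  case False
  then have "invertible (1 - a k)" "invertible (1 - a l)"
    using invertible_or_complement a_in assms by auto
  then show ?thesis using cancel_two_invertible[OF _ _ small_edge(2)[OF assms(1-3)]] by blast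
qed

text \<open>If the big entry \<open>p\<close> is noninvertible, then \<open>w\<close> is noninvertible everywhere, so that every
  vertex is close to exactly one of \<open>0\<close> and \<open>u\<close>, and the colour tells to which one. Entries of
  equal colour cannot be big. As \<open>i\<close> and \<open>j\<close> have different colours, one of them has the colour of
  \<open>k\<close> and \<open>l\<close>, and its entries with \<open>k\<close> and \<open>l\<close> are negligible; this gains the factor \<open>p\<close>.\<close>

lemma same_colour_cross:
  assumes I: "i \<in> I" "j \<in> I" and big: "big (h i j)" and p: "noninvertible (h i j)"
    and kl: "k \<in> I" "l \<in> I" and same: "invertible (a k) \<longleftrightarrow> invertible (a l)"
  shows "cross i j k l \<in> multiples (h i j * e)"
proof -
  have ji: "h j i = h i j" using h_sym I by simp
  have w_non: "noninvertible (w m)" if m: "m \<in> I" for m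
  proof -
    have mi: "h m i = h i m" "h m j = h j m" using h_sym I m by auto
    have non: "noninvertible (h i m)" "noninvertible (h j m)"
      using noninvertible_multiples[OF p] leg_below_big[OF I m] leg_below_big[OF I(2,1) m] ji big
      by auto
    show ?thesis
    proof (cases "big (h i m) \<or> big (h j m)")
      case True
      then have "w m \<in> multiples (h i m) \<or> w m \<in> multiples (h j m)"
        using big_edge_associated(1)[OF m I(1)] big_edge_associated(1)[OF m I(2)] mi by auto
      then show ?thesis using non noninvertible_multiples by blast
    next
      case False
      then show ?thesis using isolated(3)[OF I m big] below_big'(2)[OF big] by blast
    qed
  qed
  have small: "h m m' \<in> E" 
    if m: "m \<in> I" "m' \<in> I" "invertible (a m) \<longleftrightarrow> invertible (a m')" for m m'
  proof (rule same_colour_small[OF m(1,2) _ m(3)], rule)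
    assume b: "big (h m m')"
    have "noninvertible (h m m')"
      using noninvertible_multiples[OF w_non[OF m(1)]] big_edge_associated(2)[OF m(1,2) b] by blast
    moreover have u: "noninvertible (a m' - (1 - a m))"
      using below_big'(2)[OF b big_edge_coordinates(1)[OF m(1,2) b]] .
    ultimately show False
    proof (cases "invertible (a m)")
      case True
      have "invertible (1 - a m)"
        using invertible_add[OF _ noninvertible_uminus[OF u], of "a m'"] True m by simp
      then show False using w_non[OF m(1)] True invertible_mult 
        unfolding w_def noninvertible_def by blast
    next
      case False
      then have "invertible (1 - a m)" using invertible_or_complement a_in m by blast
      then show False using invertible_add[of "1 - a m" "a m' - (1 - a m)"] u False m by simp
    qed
  qed
  have colours: "invertible (a i) \<noteq> invertible (a j)"
    using small[OF I] E_not_big big by blast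
  have mul: "x * y \<in> multiples (h i j * e)" if "x \<in> E" "y \<in> multiples (h i j)" for x y
    using multiples_mult_mult[OF that(2,1)] by (simp add: mult.commute)
  have mul': "y * x \<in> multiples (h i j * e)" if "x \<in> E" "y \<in> multiples (h i j)" for x y
    using multiples_mult_mult[OF that(2,1)] .
  have legs: "h i k \<in> multiples (h i j)" "h i l \<in> multiples (h i j)" 
      "h j k \<in> multiples (h i j)" "h j l \<in> multiples (h i j)"
    using leg_below_big[OF I] leg_below_big[OF I(2,1)] kl ji big by auto
  have "h i j * h k l \<in> multiples (h i j * e)"
    using mul'[OF small[OF kl same] multiples_self] .
  moreover have "h i k * h j l \<in> multiples (h i j * e)" "h j k * h i l \<in> multiples (h i j * e)"
  proof -
    have "(h i k \<in> E \<and> h i l \<in> E) \<or> (h j k \<in> E \<and> h j l \<in> E)"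
      using colours same small[OF I(1) kl(1)] small[OF I(1) kl(2)] small[OF I(2) kl(1)] small[OF I(2) kl(2)]
      by argo
    then show "h i k * h j l \<in> multiples (h i j * e)" "h j k * h i l \<in> multiples (h i j * e)"
      using mul mul' legs by blast+
  qed
  ultimately show ?thesis unfolding cross_def by (intro multiples_diff)
qed

end

section \<open>Determinants\<close>

text \<open>\<open>X\<close> is the solution of \<open>P X = Q\<close> for the blocks \<open>P\<close>, \<open>Q\<close> in the first \<open>m\<close> rows. It replaces
  \<open>P\<^sup>-\<^sup>1 Q\<close>, so that no inverse matrix has to be computed in the applications.\<close>

lemma det_schur_complement:
  fixes f :: "nat \<Rightarrow> nat \<Rightarrow> 'a::field"
  assumes X: "\<And>r k. r < m \<Longrightarrow> k < N \<Longrightarrow> f r (m + k) = (\<Sum>c<m. f r c * X c k)"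
  shows "det (mat (m + N) (m + N) (\<lambda>(r, c). f r c)) =
    det (mat m m (\<lambda>(r, c). f r c)) *
    det (mat N N (\<lambda>(k, l). f (m + k) (m + l) - (\<Sum>c<m. f (m + k) c * X c l)))"
proof -
  define A where "A = mat (m + N) (m + N) (\<lambda>(r, c). f r c)"
  define P where "P = mat m m (\<lambda>(r, c). f r c)"
  define Q where "Q = mat m N (\<lambda>(r, k). f r (m + k))"
  define R where "R = mat N m (\<lambda>(k, c). f (m + k) c)"
  define H where "H = mat N N (\<lambda>(k, l). f (m + k) (m + l))"
  define Y where "Y = mat m N (\<lambda>(c, k). - X c k)"
  define S where "S = mat N N (\<lambda>(k, l). f (m + k) (m + l) - (\<Sum>c<m. f (m + k) c * X c l))"
  have carriers: "P \<in> carrier_mat m m" "Q \<in> carrier_mat m N" "R \<in> carrier_mat N m"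
    "H \<in> carrier_mat N N" "Y \<in> carrier_mat m N" "S \<in> carrier_mat N N"
    unfolding P_def Q_def R_def H_def Y_def S_def by auto
  have A: "A = four_block_mat P Q R H"
    unfolding A_def P_def Q_def R_def H_def by (intro eq_matI) auto
  \<comment> \<open>Right multiplication by \<open>U\<close> subtracts the combinations given by \<open>X\<close> from the last columns.\<close>
  define U where "U = four_block_mat (1\<^sub>m m) Y (0\<^sub>m N m) (1\<^sub>m N)"
  have PY: "(P * Y) $$ (r, k) = - (\<Sum>c<m. f r c * X c k)" if "r < m" "k < N" for r k
    using that by (simp add: P_def Y_def scalar_prod_def sum_negf atLeast0LessThan)
  have RY: "(R * Y) $$ (r, k) = - (\<Sum>c<m. f (m + r) c * X c k)" if "r < N" "k < N" for r k
    using that by (simp add: R_def Y_def scalar_prod_def sum_negf atLeast0LessThan)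
  have "P * Y + Q = 0\<^sub>m m N"
  proof (rule eq_matI)
    fix r k assume "r < dim_row (0\<^sub>m m N)" "k < dim_col (0\<^sub>m m N)"
    then have "r < m" "k < N" by auto
    then show "(P * Y + Q) $$ (r, k) = 0\<^sub>m m N $$ (r, k)"
      using carriers PY X[of r k] by (simp add: Q_def)
  qed (use carriers in auto)
  moreover have "R * Y + H = S"
  proof (rule eq_matI)
    fix k l assume "k < dim_row S" "l < dim_col S"
    then have "k < N" "l < N" using carriers by auto
    then show "(R * Y + H) $$ (k, l) = S $$ (k, l)"
      using carriers RY by (simp add: H_def S_def)
  qed (use carriers in auto)
  ultimately have "A * U = four_block_mat P (0\<^sub>m m N) R S"
    using mult_four_block_mat[OF carriers(1-4) one_carrier_mat carriers(5) zero_carrier_mat one_carrier_mat]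
      carriers
    by (simp add: A U_def)
  then have "det (A * U) = det P * det S"
    using carriers by (simp add: det_four_block_mat_upper_right_zero)
  moreover have "det U = 1"
    using det_four_block_mat_lower_left_zero[OF one_carrier_mat carriers(5) refl one_carrier_mat]
    by (simp add: U_def)
  moreover have "det (A * U) = det A * det U"
    by (rule det_mult[of _ "m + N"]) (auto simp: A_def U_def)
  ultimately show ?thesis unfolding A_def P_def S_def by simp
qed

lemma det_relabel:
  fixes f :: "nat \<Rightarrow> nat \<Rightarrow> 'a::comm_ring_1"
  assumes \<pi>: "\<pi> permutes {0..<N}"
  shows "det (mat N N (\<lambda>(r, c). f (\<pi> r) (\<pi> c))) = det (mat N N (\<lambda>(r, c). f r c))"
proof -
  have lt: "\<pi> r < N" if "r < N" for r using permutes_in_image[OF \<pi>, of r] that by simp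
  let ?A = "mat N N (\<lambda>(r, c). f r c)"
  let ?B = "mat N N (\<lambda>(r, c). f (\<pi> r) c)"
  let ?C = "mat N N (\<lambda>(r, c). f (\<pi> r) (\<pi> c))"
  have B: "det ?B = signof \<pi> * det ?A"
    by (subst det_permute_rows[OF _ \<pi>, of ?A, symmetric]) (auto intro!: arg_cong[of _ _ det] simp: lt)
  have "det ?C = det (transpose_mat ?C)" by (rule det_transpose[of _ N, symmetric]) simp
  also have "transpose_mat ?C = mat N N (\<lambda>(r, c). transpose_mat ?B $$ (\<pi> r, c))"
    by (intro eq_matI) (auto simp: lt)
  also have "det \<dots> = signof \<pi> * det (transpose_mat ?B)"
    by (rule det_permute_rows[OF _ \<pi>]) simp
  also have "det (transpose_mat ?B) = det ?B" by (rule det_transpose[of _ N]) simp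
  finally show ?thesis using B by (simp add: sign_def split: if_splits)
qed

text \<open>Otherwise the permutation would interchange the two colour classes, which would then have the
  same number of elements.\<close>

lemma permutation_fixes_colour:
  assumes \<pi>: "\<pi> permutes {0..<N::nat}" and "odd N"
  obtains k where "k < N" "colour (\<pi> k) = (colour k :: bool)"
proof (rule ccontr)
  note fixed = that
  assume "\<not> thesis"
  then have flip: "colour (\<pi> k) \<noteq> colour k" if "k < N" for k using that fixed by blast
  let ?T = "{k \<in> {0..<N}. colour k}" and ?F = "{k \<in> {0..<N}. \<not> colour k}"
  have inj: "inj_on \<pi> S" for S using permutes_inj_on[OF \<pi>] .
  have lt: "\<pi> k < N" if "k < N" for k using permutes_in_image[OF \<pi>, of k] that by simp
  have "\<pi> ` ?T \<subseteq> ?F" "\<pi> ` ?F \<subseteq> ?T" using flip lt by auto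
  then have "card ?T \<le> card ?F" "card ?F \<le> card ?T"
    by (auto intro!: card_inj_on_le inj)
  moreover have "card {0..<N} = card ?T + card ?F"
  proof -
    have "{0..<N} = ?T \<union> ?F" by auto
    then show ?thesis by (metis (no_types, lifting) card_Un_disjoint disjoint_iff finite_Collect_conjI finite_atLeastLessThan mem_Collect_eq finite_Un)
  qed
  ultimately have "N = 2 * card ?T" by simp
  then show False using \<open>odd N\<close> by (metis dvd_triv_left)
qed

text \<open>Every summand of the determinant contains an entry of two equal colours, by
  \<open>permutation_fixes_colour\<close>.\<close>

lemma (in valuation_ring) det_coloured:
  assumes "odd N"
    and y: "\<And>k l. k < N \<Longrightarrow> l < N \<Longrightarrow> y k l \<in> multiples b"
    and same: "\<And>k l. k < N \<Longrightarrow> l < N \<Longrightarrow> (colour k :: bool) = colour l \<Longrightarrow> y k l \<in> multiples (g * b)"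
  shows "det (mat N N (\<lambda>(k, l). y k l)) \<in> multiples (g * b ^ N)"
proof -
  have summand: "(\<Prod>k=0..<N. y k (\<pi> k)) \<in> multiples (g * b ^ N)" if \<pi>: "\<pi> permutes {0..<N}" for \<pi>
  proof -
    have lt: "\<pi> k < N" if "k < N" for k using permutes_in_image[OF \<pi>, of k] that by simp
    obtain k where k: "k < N" "colour (\<pi> k) = colour k"
      using permutation_fixes_colour[OF \<pi> \<open>odd N\<close>] by blast
    have "(\<Prod>k=0..<N. y k (\<pi> k)) = y k (\<pi> k) * (\<Prod>k\<in>{0..<N} - {k}. y k (\<pi> k))"
      using k by (subst prod.remove[of _ k]) auto
    also have "\<dots> \<in> multiples ((g * b) * (\<Prod>k\<in>{0..<N} - {k}. b))"
      using k lt y same by (intro multiples_mult_mult multiples_prod) auto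
    also have "(g * b) * (\<Prod>k\<in>{0..<N} - {k}. b) = g * b ^ N"
      using k by (simp flip: power_Suc)
    finally show ?thesis .
  qed
  have "det (mat N N (\<lambda>(k, l). y k l)) = (\<Sum>\<pi> | \<pi> permutes {0..<N}. signof \<pi> * (\<Prod>k=0..<N. y k (\<pi> k)))"
  proof -
    have "(\<Prod>k=0..<N. mat N N (\<lambda>(k, l). y k l) $$ (k, \<pi> k)) = (\<Prod>k=0..<N. y k (\<pi> k))"
      if "\<pi> permutes {0..<N}" for \<pi>
      using permutes_in_image[OF that] by (intro prod.cong) auto
    then show ?thesis by (subst det_def') (auto intro!: sum.cong)
  qed
  also have "\<dots> \<in> multiples (g * b ^ N)"
    using summand by (intro multiples_sum multiples_mult_left) (auto simp: sign_def)
  finally show ?thesis .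
qed

lemma det_mat_2:
  fixes f :: "nat \<Rightarrow> nat \<Rightarrow> 'a::field"
  shows "det (mat 2 2 (\<lambda>(r, c). f r c)) = f 0 0 * f 1 1 - f 0 1 * f 1 0"
proof -
  let ?e = "\<lambda>r c. mat 1 1 (\<lambda>_. f r c)"
  have blocks: "mat 2 2 (\<lambda>(r, c). f r c) = four_block_mat (?e 0 0) (?e 0 1) (?e 1 0) (?e 1 1)"
    by (intro eq_matI) (auto simp: numeral_2_eq_2 less_Suc_eq)
  have commute: "?e 1 0 * ?e 1 1 = ?e 1 1 * ?e 1 0"
    by (rule eq_matI) (simp_all add: scalar_prod_def mult.commute)
  have carrier: "?e 0 0 * ?e 1 1 - ?e 0 1 * ?e 1 0 \<in> carrier_mat 1 1"
    by (rule minus_carrier_mat, rule mult_carrier_mat) (rule mat_carrier)+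
  show ?thesis
    unfolding blocks det_four_block_mat[OF mat_carrier mat_carrier mat_carrier mat_carrier commute]
      det_single[OF carrier]
    by (simp add: scalar_prod_def)
qed

lemma permutation_with_two_values:
  assumes "i < N" "j < N" "i \<noteq> j" "2 \<le> (N::nat)"
  obtains \<pi> where "\<pi> permutes {0..<N}" "\<pi> 0 = i" "\<pi> 1 = j"
proof -
  define j' where "j' = transpose 0 i j"
  define \<pi> where "\<pi> = transpose 0 i \<circ> transpose 1 j'"
  have "j' < N" "j' \<noteq> 0" unfolding j'_def transpose_def using assms by auto
  then have "\<pi> permutes {0..<N}" "\<pi> 0 = i" "\<pi> 1 = j"
    using assms unfolding \<pi>_def
    by (auto intro!: permutes_compose permutes_swap_id simp: j'_def)
  then show ?thesis using that by blast
qed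

lemma (in degenerate_triangles) degenerate_triangles_relabel:
  assumes "f ` J \<subseteq> I"
  shows "degenerate_triangles B e J (\<lambda>k. a (f k)) (\<lambda>k l. h (f k) (f l))"
proof -
  have f: "f k \<in> I" if "k \<in> J" for k using assms that by auto
  have "triangle_defect (\<lambda>k. a (f k)) (\<lambda>k l. h (f k) (f l)) i j k = triangle_defect a h (f i) (f j) (f k)" for i j k
    by (simp add: triangle_defect_def)
  then show ?thesis
    by unfold_locales (use e a_in h_in h_sym h_diag face0 face1 face f in simp_all)
qed

text \<open>All entries are multiples of \<open>\<epsilon>\<close>, those of equal colour even of \<open>\<epsilon>\<^sup>2\<close>. The odd order
  provides the one additional factor \<open>\<epsilon>\<close>.\<close>

lemma (in valuation_ring) det_no_big_entry:
  assumes "degenerate_triangles B (\<epsilon>\<^sup>2) {..<M} a h" and "odd M"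
    and small: "\<And>k l. k < M \<Longrightarrow> l < M \<Longrightarrow> \<not> degenerate_triangles.big B (\<epsilon>\<^sup>2) (h k l)"
  shows "det (mat M M (\<lambda>(k, l). h k l)) \<in> multiples (\<epsilon> ^ (M + 1))"
proof -
  interpret D: degenerate_triangles B "\<epsilon>\<^sup>2" "{..<M}" a h by fact
  have "det (mat M M (\<lambda>(k, l). h k l)) \<in> multiples (\<epsilon> * \<epsilon> ^ M)"
  proof (rule det_coloured[OF \<open>odd M\<close>, of h \<epsilon> "\<lambda>k. invertible (a k)"])
    fix k l assume kl: "k < M" "l < M"
    then have "(h k l)\<^sup>2 \<in> multiples (\<epsilon>\<^sup>2)" using small[OF kl] D.h_in[of k l] by (simp add: D.big_def)
    then show "h k l \<in> multiples \<epsilon>" by (rule multiples_sqrt)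
    assume "invertible (a k) = invertible (a l)"
    then have "h k l \<in> multiples (\<epsilon>\<^sup>2)" using D.same_colour_small small kl by auto
    then show "h k l \<in> multiples (\<epsilon> * \<epsilon>)" by (simp add: power2_eq_square)
  qed
  then show ?thesis by simp
qed

text \<open>Split off the first two rows, whose minor is \<open>p\<^sup>2\<close> up to an invertible factor, where \<open>p\<close> is the
  big entry. The entries \<open>S k l\<close> of the Schur complement satisfy \<open>p \<cdot> S k l \<in> multiples e\<close>, and
  those of equal colour satisfy \<open>S k l \<in> multiples e\<close>. With \<open>N = M - 2\<close> this makes the determinant a
  multiple of \<open>p\<^sup>3 e ^ N / p ^ N\<close>, that is, of \<open>\<epsilon> ^ (M + 1) \<cdot> (\<epsilon> / p) ^ (N - 3)\<close>. This is where
  \<open>5 \<le> M\<close>, which corresponds to simplices of dimension at least six, is used.\<close>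

lemma (in valuation_ring) det_big_entry:
  assumes "degenerate_triangles B (\<epsilon>\<^sup>2) {..<M} a h" and M: "odd M" "5 \<le> M"
    and big: "degenerate_triangles.big B (\<epsilon>\<^sup>2) (h 0 1)"
  shows "det (mat M M (\<lambda>(k, l). h k l)) \<in> multiples (\<epsilon> ^ (M + 1))"
proof -
  interpret D: degenerate_triangles B "\<epsilon>\<^sup>2" "{..<M}" a h by fact
  define N where "N = M - 2"
  have MN: "M = 2 + N" "3 \<le> N" "odd N" using M by (auto simp: N_def)
  define p e where "p = h 0 1" "e = \<epsilon>\<^sup>2"
  have eB: "e \<in> B" using D.e by (simp add: p_e_def noninvertible_def)
  have big': "D.big p" using big by (simp add: p_e_def)
  have p0: "p \<noteq> 0" "p \<in> B" using big' D.big_nonzero by (auto simp: D.big_def)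
  have I: "0 \<in> {..<M}" "1 \<in> {..<M}" "\<And>k. k < N \<Longrightarrow> 2 + k \<in> {..<M}" using MN by auto
  define q r where "q k = h 0 (2 + k)" and "r k = h 1 (2 + k)" for k
  define \<Delta> where "\<Delta> = h 0 0 * h 1 1 - p * p"
  have h00: "h 0 0 \<in> multiples e" and h11: "h 1 1 \<in> multiples e"
    using D.h_diag I by (auto simp: p_e_def)
  have h11p: "h 1 1 \<in> multiples p" "h 1 1 \<in> B" "h 0 0 \<in> B"
    using D.not_big_below_big[OF big'] D.E_not_big h11 h00 D.h_in I by (auto simp: p_e_def)
  have h10: "h 1 0 = p" using D.h_sym I by (simp add: p_e_def)
  have legs: "q k \<in> multiples p" "r k \<in> multiples p" "q k \<in> B" "r k \<in> B" if "k < N" for k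
    using D.leg_below_big[OF I(1,2) I(3)[OF that]] D.leg_below_big[OF I(2,1) I(3)[OF that]]
      big h10 that D.h_in[OF I(1) I(3)[OF that]] D.h_in[OF I(2) I(3)[OF that]]
    by (auto simp: q_def r_def p_e_def)
  obtain v where v: "invertible v" "\<Delta> = p * p * v"
  proof -
    have "h 0 0 * h 1 1 \<in> multiples e" using h00 h11p by (intro multiples_mult_right)
    then obtain \<mu> where \<mu>: "noninvertible \<mu>" "h 0 0 * h 1 1 = p * p * \<mu>"
      using D.E_below_big[OF big'] by (auto simp: p_e_def)
    have "invertible (- 1 + \<mu>)"
      using invertible_add[OF _ \<mu>(1), of "-1"] invertible_of_rat[of "-1"] by simp
    moreover have "\<Delta> = p * p * (- 1 + \<mu>)" unfolding \<Delta>_def \<mu>(2) by (simp add: algebra_simps)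
    ultimately show ?thesis using that by blast
  qed
  have \<Delta>0: "\<Delta> \<noteq> 0" using v p0 by (auto simp: invertible_def)
  \<comment> \<open>Cramer's rule\<close>
  define X where "X c k = (if c = 0 then (h 1 1 * q k - p * r k) / \<Delta> else (h 0 0 * r k - p * q k) / \<Delta>)" for c k :: nat
  define S where "S k l = h (2 + k) (2 + l) - (\<Sum>c<2. h (2 + k) c * X c l)" for k l
  have "det (mat M M (\<lambda>(k, l). h k l)) = det (mat 2 2 (\<lambda>(k, l). h k l)) * det (mat N N (\<lambda>(k, l). S k l))"
    unfolding MN(1) S_def
  proof (rule det_schur_complement)
    fix s k :: nat assume "s < 2" "k < N"
    then have s: "s = 0 \<or> s = 1" by auto
    have "h 0 0 * (h 1 1 * q k - p * r k) + p * (h 0 0 * r k - p * q k) = \<Delta> * q k"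
      "p * (h 1 1 * q k - p * r k) + h 1 1 * (h 0 0 * r k - p * q k) = \<Delta> * r k"
      unfolding \<Delta>_def by (simp_all add: algebra_simps)
    then have "h 0 0 * ((h 1 1 * q k - p * r k) / \<Delta>) + p * ((h 0 0 * r k - p * q k) / \<Delta>) = q k"
      "p * ((h 1 1 * q k - p * r k) / \<Delta>) + h 1 1 * ((h 0 0 * r k - p * q k) / \<Delta>) = r k"
      using \<Delta>0 by (simp_all add: field_simps)
    then show "h s (2 + k) = (\<Sum>c<2. h s c * X c k)"
      using s h10 by (auto simp: X_def q_def r_def p_e_def numeral_2_eq_2)
  qed
  also have "det (mat 2 2 (\<lambda>(k, l). h k l)) = \<Delta>"
    unfolding det_mat_2 \<Delta>_def h10 p_e_def(1)[symmetric] ..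
  finally have det: "det (mat M M (\<lambda>(k, l). h k l)) = \<Delta> * det (mat N N (\<lambda>(k, l). S k l))" .
  \<comment> \<open>The diagonal entries \<open>h 0 0\<close> and \<open>h 1 1\<close> change the Schur complement by a negligible amount
    only.\<close>
  have pS: "p * S k l - D.cross 0 1 (2 + k) (2 + l) \<in> multiples (p * e)" if kl: "k < N" "l < N" for k l
  proof -
    have sym: "h (2 + k) 0 = q k" "h (2 + k) 1 = r k"
      using D.h_sym[OF I(3)[OF kl(1)] I(1)] D.h_sym[OF I(3)[OF kl(1)] I(2)] by (auto simp: q_def r_def)
    obtain q' r' where q': "q k = p * q'" "q' \<in> B" and r': "r k = p * r'" "r' \<in> B"
      using legs(1,2)[OF kl(1)] by (auto elim!: multiplesE)
    obtain q'' r'' where q'': "q l = p * q''" "q'' \<in> B" and r'': "r l = p * r''" "r'' \<in> B"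
      using legs(1,2)[OF kl(2)] by (auto elim!: multiplesE)
    have iv: "inverse v \<in> B" "v \<noteq> 0" using v by (auto simp: invertible_def)
    have "p * S k l - D.cross 0 1 (2 + k) (2 + l) =
      (h 0 0 * h 1 1 * (q k * r l + r k * q l) - p * (q k * q l * h 1 1 + r k * r l * h 0 0)) / \<Delta>"
    proof -
      have S: "S k l = h (2 + k) (2 + l) - (q k * (h 1 1 * q l - p * r l) + r k * (h 0 0 * r l - p * q l)) / \<Delta>"
        unfolding S_def X_def using sym by (simp add: numeral_2_eq_2 add_divide_distrib)
      have "\<Delta> * (p * S k l - D.cross 0 1 (2 + k) (2 + l)) =
        h 0 0 * h 1 1 * (q k * r l + r k * q l) - p * (q k * q l * h 1 1 + r k * r l * h 0 0)"
        unfolding S D.cross_def p_e_def(1)[symmetric] q_def[symmetric] r_def[symmetric]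
        using \<Delta>0 by (simp add: field_simps) (simp add: \<Delta>_def algebra_simps)
      then show ?thesis using \<Delta>0 by (simp add: field_simps)
    qed
    also have "\<dots> = h 1 1 * h 0 0 * (inverse v * (q' * r'' + r' * q''))
        - p * h 1 1 * (inverse v * (q' * q'')) - p * h 0 0 * (inverse v * (r' * r''))"
      unfolding q' q'' r' r'' v(2) using p0 iv by (simp add: field_simps)
    also have "\<dots> \<in> multiples (p * e)"
      using h11p h00 h11 q' q'' r' r'' iv
      by (intro multiples_diff multiples_mult_right multiples_mult_mult multiples_self) auto
    finally show ?thesis .
  qed
  have pe: "x \<in> multiples (p * e) \<Longrightarrow> x \<in> multiples e" for x
    using multiples_trans[of x "p * e" e] multiples_mult_left[OF multiples_self p0(2), of e] by blast
  define y where "y k l = p * S k l" for k l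
  have y: "y k l \<in> multiples e" if kl: "k < N" "l < N" for k l
  proof -
    have "D.cross 0 1 (2 + k) (2 + l) + (p * S k l - D.cross 0 1 (2 + k) (2 + l)) \<in> multiples e"
      using D.cross_in[OF I(1,2) I(3)[OF kl(1)] I(3)[OF kl(2)] big] pe[OF pS[OF kl]]
      by (intro multiples_add) (auto simp: p_e_def)
    then show ?thesis by (simp add: y_def)
  qed
  \<comment> \<open>If \<open>p\<close> is invertible, the factor \<open>p\<close> is no additional condition.\<close>
  have same: "y k l \<in> multiples (p * e)"
    if kl: "k < N" "l < N" "invertible (a (2 + k)) = invertible (a (2 + l))" for k l
  proof (cases "noninvertible p")
    case True
    have "D.cross 0 1 (2 + k) (2 + l) + (p * S k l - D.cross 0 1 (2 + k) (2 + l)) \<in> multiples (p * e)"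
      using D.same_colour_cross[OF I(1,2) big _ I(3)[OF kl(1)] I(3)[OF kl(2)] kl(3)] True pS[OF kl(1,2)]
      by (intro multiples_add) (auto simp: p_e_def)
    then show ?thesis by (simp add: y_def)
  next
    case False
    then have "inverse p \<in> B" using p0 by (auto simp: noninvertible_def invertible_def)
    then have "e \<in> multiples (p * e)" using p0 by (intro multiplesI[of _ _ "inverse p"]) auto
    then show ?thesis using y[OF kl(1,2)] multiples_trans by blast
  qed
  have "det (mat N N (\<lambda>(k, l). y k l)) \<in> multiples (p * e ^ N)"
    by (rule det_coloured[OF MN(3) y same]) auto
  moreover have "mat N N (\<lambda>(k, l). y k l) = p \<cdot>\<^sub>m mat N N (\<lambda>(k, l). S k l)"
    by (intro eq_matI) (auto simp: y_def)
  ultimately have dS: "p ^ N * det (mat N N (\<lambda>(k, l). S k l)) \<in> multiples (p * e ^ N)"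
    by simp
  have "\<Delta> \<in> multiples (p * p)" using v by (auto intro: multiplesI simp: invertible_def)
  then have "\<Delta> * (p ^ N * det (mat N N (\<lambda>(k, l). S k l))) \<in> multiples ((p * p) * (p * e ^ N))"
    using dS by (rule multiples_mult_mult)
  also have "\<Delta> * (p ^ N * det (mat N N (\<lambda>(k, l). S k l))) = p ^ 3 * (p ^ (N - 3) * det (mat M M (\<lambda>(k, l). h k l)))"
  proof -
    have "p ^ N = p ^ 3 * p ^ (N - 3)" using MN(2) by (simp flip: power_add)
    then show ?thesis by (simp add: det)
  qed
  also have "(p * p) * (p * e ^ N) = p ^ 3 * e ^ N" by (simp add: power3_eq_cube)
  finally have 1: "p ^ (N - 3) * det (mat M M (\<lambda>(k, l). h k l)) \<in> multiples (e ^ N)"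
    using multiples_cancel[of "p ^ 3"] p0 by simp
  have "\<epsilon> \<in> multiples p"
  proof -
    have "p \<notin> multiples \<epsilon>"
    proof
      assume "p \<in> multiples \<epsilon>"
      then have "p\<^sup>2 \<in> multiples (\<epsilon>\<^sup>2)" by (rule multiples_power)
      then show False using big' by (simp add: D.big_def)
    qed
    then show ?thesis using multiples_linear by blast
  qed
  then have "\<epsilon> ^ (N - 3) * \<epsilon> ^ (N + 3) \<in> multiples (p ^ (N - 3) * \<epsilon> ^ (N + 3))"
    by (intro multiples_mult_mult multiples_power multiples_self)
  also have "\<epsilon> ^ (N - 3) * \<epsilon> ^ (N + 3) = e ^ N"
    using MN(2) by (simp add: p_e_def flip: power_add power_mult) 
  finally have "p ^ (N - 3) * det (mat M M (\<lambda>(k, l). h k l)) \<in> multiples (p ^ (N - 3) * \<epsilon> ^ (N + 3))"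
    using 1 multiples_trans by blast
  then have "det (mat M M (\<lambda>(k, l). h k l)) \<in> multiples (\<epsilon> ^ (N + 3))"
    using multiples_cancel p0 by simp
  moreover have "M + 1 = N + 3" using MN(1) by simp
  ultimately show ?thesis by (simp only:)
qed

theorem (in valuation_ring) det_degenerate_triangles:
  assumes "degenerate_triangles B (\<epsilon>\<^sup>2) {..<M} a h" and M: "odd M" "5 \<le> M"
  shows "det (mat M M (\<lambda>(k, l). h k l)) \<in> multiples (\<epsilon> ^ (M + 1))"
proof -
  interpret D: degenerate_triangles B "\<epsilon>\<^sup>2" "{..<M}" a h by fact
  show ?thesis
  proof (cases "\<exists>i<M. \<exists>j<M. D.big (h i j)")
    case False
    then show ?thesis using det_no_big_entry[OF assms(1,2)] by blast
  next
    case True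
    then obtain i j where ij: "i < M" "j < M" "D.big (h i j)" by blast
    then have "i \<noteq> j" using D.h_diag D.E_not_big by auto
    then obtain \<pi> where \<pi>: "\<pi> permutes {0..<M}" "\<pi> 0 = i" "\<pi> 1 = j"
      using permutation_with_two_values[of i M j] ij M by auto
    have "\<pi> ` {..<M} \<subseteq> {..<M}" using permutes_image[OF \<pi>(1)] by (auto simp: atLeast0LessThan)
    then have "det (mat M M (\<lambda>(k, l). h (\<pi> k) (\<pi> l))) \<in> multiples (\<epsilon> ^ (M + 1))"
      using det_big_entry[OF D.degenerate_triangles_relabel M] ij \<pi> by simp
    then show ?thesis by (simp add: det_relabel[OF \<pi>(1)])
  qed
qed

section \<open>Cayley-Menger determinants\<close>

text \<open>Sixteen times the squared area of a triangle in terms of its squared edge lengths.\<close>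

definition heron :: "'a::comm_ring_1 \<Rightarrow> 'a \<Rightarrow> 'a \<Rightarrow> 'a" where
  "heron x y z = 2 * x * y + 2 * y * z + 2 * z * x - x\<^sup>2 - y\<^sup>2 - z\<^sup>2"

text \<open>Entries of the Cayley-Menger matrix for given squared distances \<open>s\<close>. Working with \<open>s\<close> instead
  of the lengths allows rescaling and explicit families without square roots.\<close>

definition cm_entry :: "(nat \<Rightarrow> nat \<Rightarrow> 'a::zero_neq_one) \<Rightarrow> nat \<Rightarrow> nat \<Rightarrow> 'a" where
  "cm_entry s r c = (if r = c then 0 else if r = 0 \<or> c = 0 then 1 else s (r - 1) (c - 1))"

definition cm_det :: "nat \<Rightarrow> (nat \<Rightarrow> nat \<Rightarrow> 'a::comm_ring_1) \<Rightarrow> 'a" where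
  "cm_det n s = det (mat (n + 2) (n + 2) (\<lambda>(r, c). cm_entry s r c))"

definition squared_distances :: "nat \<Rightarrow> (nat \<Rightarrow> nat \<Rightarrow> 'a::zero) \<Rightarrow> bool" where
  "squared_distances n s \<longleftrightarrow> (\<forall>i\<le>n. s i i = 0) \<and> (\<forall>i\<le>n. \<forall>j\<le>n. s i j = s j i)"

lemma cm_det_relabel:
  assumes \<pi>: "\<pi> permutes {0..<n + 1}"
  shows "cm_det n (\<lambda>i j. s (\<pi> i) (\<pi> j)) = cm_det n s"
proof -
  define \<rho> where "\<rho> r = (if r = 0 then 0 else Suc (\<pi> (r - 1)))" for r
  have inj: "\<rho> r = \<rho> c \<longleftrightarrow> r = c" for r c
    using permutes_inj[OF \<pi>] by (cases r; cases c) (auto simp: \<rho>_def inj_eq)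
  have "\<rho> permutes {0..<n + 2}"
  proof (rule bij_imp_permutes)
    have "\<rho> ` {0..<n + 2} \<subseteq> {0..<n + 2}"
    proof
      fix c assume "c \<in> \<rho> ` {0..<n + 2}"
      then obtain r where r: "r < n + 2" "c = \<rho> r" by auto
      show "c \<in> {0..<n + 2}"
        using permutes_in_image[OF \<pi>, of "r - 1"] r by (auto simp: \<rho>_def)
    qed
    then have "\<rho> ` {0..<n + 2} = {0..<n + 2}"
      by (intro card_subset_eq) (auto simp: card_image inj_on_def inj)
    then show "bij_betw \<rho> {0..<n + 2} {0..<n + 2}"
      by (simp add: bij_betw_def inj_on_def inj)
  next
    fix r assume r: "r \<notin> {0..<n + 2}"
    then show "\<rho> r = r" using permutes_not_in[OF \<pi>, of "r - 1"] by (auto simp: \<rho>_def)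
  qed
  moreover have "cm_entry (\<lambda>i j. s (\<pi> i) (\<pi> j)) r c = cm_entry s (\<rho> r) (\<rho> c)" for r c
    unfolding cm_entry_def inj by (auto simp: \<rho>_def)
  then have "cm_entry (\<lambda>i j. s (\<pi> i) (\<pi> j)) = (\<lambda>r c. cm_entry s (\<rho> r) (\<rho> c))" by blast
  ultimately show ?thesis unfolding cm_det_def using det_relabel[of \<rho> "n + 2" "cm_entry s"]
    by (simp only:)
qed

text \<open>The coordinate of the vertex \<open>k + 2\<close> along the edge from vertex \<open>0\<close> to vertex \<open>1\<close>, where vertex
  \<open>0\<close> has coordinate \<open>0\<close> and vertex \<open>1\<close> has coordinate \<open>1\<close>.\<close>

definition axis_coord :: "(nat \<Rightarrow> nat \<Rightarrow> 'a::field_char_0) \<Rightarrow> nat \<Rightarrow> 'a" where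
  "axis_coord s k = (s 0 1 + s 0 (k + 2) - s 1 (k + 2)) / (2 * s 0 1)"

text \<open>The Gram matrix of the components of the vectors from vertex \<open>0\<close> to the vertices \<open>k + 2\<close> that
  are orthogonal to the edge between the vertices \<open>0\<close> and \<open>1\<close>, in units in which the squared length
  of that edge is \<open>1\<close>.\<close>

definition axis_gram :: "(nat \<Rightarrow> nat \<Rightarrow> 'a::field_char_0) \<Rightarrow> nat \<Rightarrow> nat \<Rightarrow> 'a" where
  "axis_gram s k l = (s 0 (k + 2) + s 0 (l + 2) - s (k + 2) (l + 2)) / (2 * s 0 1)
     - axis_coord s k * axis_coord s l"

lemma squared_distances_axis:
  assumes s: "squared_distances n s" and n: "1 \<le> n" and T: "s 0 1 \<noteq> 0"
    and kl: "k < n - 1" "l < n - 1"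
  shows "s 0 (k + 2) = s 0 1 * (axis_gram s k k + (axis_coord s k)\<^sup>2)" (is ?t1)
    and "s 1 (k + 2) = s 0 1 * (axis_gram s k k + (1 - axis_coord s k)\<^sup>2)" (is ?t2)
    and "s (k + 2) (l + 2) = s 0 1 *
      (axis_gram s k k + axis_gram s l l + (axis_coord s k - axis_coord s l)\<^sup>2 - 2 * axis_gram s k l)" (is ?t3)
proof -
  have kk: "s (k + 2) (k + 2) = 0" "s (l + 2) (l + 2) = 0" using s n kl by (auto simp: squared_distances_def)
  have g: "s 0 (m + 2) = s 0 1 * (axis_gram s m m + (axis_coord s m)\<^sup>2)" if "s (m + 2) (m + 2) = 0" for m
    unfolding axis_gram_def using T that by (simp add: field_simps power2_eq_square)
  then show ?t1 using kk by blast
  have "s 1 (k + 2) = s 0 1 + s 0 (k + 2) - 2 * s 0 1 * axis_coord s k"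
    unfolding axis_coord_def using T by (simp add: field_simps)
  then show ?t2 unfolding g[OF kk(1)] by (simp add: algebra_simps power2_eq_square)
  have "s (k + 2) (l + 2) = s 0 (k + 2) + s 0 (l + 2) - 2 * s 0 1 * (axis_gram s k l + axis_coord s k * axis_coord s l)"
    unfolding axis_gram_def using T by (simp add: field_simps)
  then show ?t3 unfolding g[OF kk(1)] g[OF kk(2)] by (simp add: algebra_simps power2_eq_square)
qed

lemma axis_gram_sym:
  assumes "squared_distances n s" "k < n - 1" "l < n - 1"
  shows "axis_gram s k l = axis_gram s l k"
proof -
  have "s (k + 2) (l + 2) = s (l + 2) (k + 2)" using assms by (auto simp: squared_distances_def)
  then show ?thesis unfolding axis_gram_def by (simp add: algebra_simps)
qed

text \<open>Schur complement of the block that belongs to the rows \<open>*\<close>, \<open>0\<close>, \<open>1\<close>. The block itself has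
  determinant \<open>2 \<cdot> s 0 1\<close>, and the complement is \<open>- 2 \<cdot> s 0 1\<close> times the Gram matrix.\<close>

lemma cm_det_axis_gram:
  assumes s: "squared_distances n s" and n: "1 \<le> n" and T: "s 0 1 \<noteq> 0"
  shows "cm_det n s = 2 * s 0 1 * (- 2 * s 0 1) ^ (n - 1) *
    det (mat (n - 1) (n - 1) (\<lambda>(k, l). axis_gram s k l))"
proof -
  define N where "N = n - 1"
  have nN: "n + 2 = 3 + N" using n by (simp add: N_def)
  define T where "T = s 0 1"
  have T0: "T \<noteq> 0" using \<open>s 0 1 \<noteq> 0\<close> by (simp add: T_def)
  define a h where "a = axis_coord s" and "h = axis_gram s"
  \<comment> \<open>Columns of vertices are combined with barycentric weights; the column \<open>*\<close> corrects row \<open>0\<close>.\<close>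
  define X where "X c l = (if c = 0 then s 0 (l + 2) - T * a l else if c = 1 then 1 - a l else a l)" for c l :: nat
  have s10: "s 1 0 = T" using s n by (simp add: squared_distances_def T_def)
  have s0: "s 0 (k + 2) = T * (h k k + (a k)\<^sup>2)" and s1: "s 1 (k + 2) = T * (h k k + (1 - a k)\<^sup>2)" 
    if "k < N" for k
    using squared_distances_axis(1,2)[OF s n \<open>s 0 1 \<noteq> 0\<close>, of k k] that by (simp_all add: T_def a_def h_def N_def)
  have skl: "s (k + 2) (l + 2) = T * (h k k + h l l + (a k - a l)\<^sup>2 - 2 * h k l)" if "k < N" "l < N" for k l
    using squared_distances_axis(3)[OF s n \<open>s 0 1 \<noteq> 0\<close>, of k l] that by (simp add: T_def a_def h_def N_def)
  have "cm_det n s = det (mat 3 3 (\<lambda>(r, c). cm_entry s r c)) *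
      det (mat N N (\<lambda>(k, l). cm_entry s (3 + k) (3 + l) - (\<Sum>c<3. cm_entry s (3 + k) c * X c l)))"
    unfolding cm_det_def nN
  proof (rule det_schur_complement)
    fix r k :: nat assume "r < 3" and k: "k < N"
    then consider "r = 0" | "r = 1" | "r = 2" by linarith
    then show "cm_entry s r (3 + k) = (\<Sum>c<3. cm_entry s r c * X c k)"
    proof cases
      case 3
      have "s 1 (k + 2) = s 0 (k + 2) - T * a k + T * (1 - a k)"
        unfolding s0[OF k] s1[OF k] by (simp add: algebra_simps power2_eq_square)
      then show ?thesis using 3 s10
        by (simp add: cm_entry_def X_def numeral_3_eq_3 eval_nat_numeral T_def)
    qed (auto simp: cm_entry_def X_def numeral_3_eq_3 eval_nat_numeral T_def)
  qed
  also have "mat N N (\<lambda>(k, l). cm_entry s (3 + k) (3 + l) - (\<Sum>c<3. cm_entry s (3 + k) c * X c l)) =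
      (- 2 * T) \<cdot>\<^sub>m mat N N (\<lambda>(k, l). h k l)" (is "?L = ?R")
  proof (rule eq_matI)
    fix k l assume "k < dim_row ?R" "l < dim_col ?R"
    then have kl: "k < N" "l < N" by auto
    have sym: "s (k + 2) 0 = s 0 (k + 2)" "s (k + 2) 1 = s 1 (k + 2)"
      using s kl by (auto simp: squared_distances_def N_def)
    have diag: "cm_entry s (3 + k) (3 + l) = s (k + 2) (l + 2)"
      using s kl by (auto simp: cm_entry_def squared_distances_def N_def eval_nat_numeral)
    have expand: "(\<Sum>c<3. cm_entry s (3 + k) c * X c l) =
        s 0 (l + 2) - T * a l + s (k + 2) 0 * (1 - a l) + s (k + 2) 1 * a l"
      by (simp add: cm_entry_def X_def numeral_3_eq_3 eval_nat_numeral)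
    have "cm_entry s (3 + k) (3 + l) - (\<Sum>c<3. cm_entry s (3 + k) c * X c l) = - 2 * T * h k l"
      unfolding expand diag sym s0[OF kl(1)] s0[OF kl(2)] s1[OF kl(1)] skl[OF kl]
      by (simp add: algebra_simps power2_eq_square)
    then show "?L $$ (k, l) = ?R $$ (k, l)" using kl by simp
  qed auto
  also have "det (mat 3 3 (\<lambda>(r, c). cm_entry s r c)) = 2 * T"
  proof -
    have "det (mat (2 + 1) (2 + 1) (\<lambda>(r, c). cm_entry s r c)) =
      det (mat 2 2 (\<lambda>(r, c). cm_entry s r c)) *
      det (mat 1 1 (\<lambda>(k, l). cm_entry s (2 + k) (2 + l) -
        (\<Sum>c<2. cm_entry s (2 + k) c * (if c = 0 then T else 1))))"
      by (rule det_schur_complement)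
        (auto simp: cm_entry_def T_def less_Suc_eq numeral_2_eq_2)
    also have "\<dots> = 2 * T"
      unfolding det_mat_2 using s10
      by (simp add: cm_entry_def T_def det_single[of _] numeral_2_eq_2)
    finally show ?thesis by simp
  qed
  finally show ?thesis by (simp add: T_def N_def h_def)
qed

section \<open>Boundedness of the volume in even dimension at least six\<close>

context valuation_ring begin

text \<open>Choose the edge between the vertices \<open>0\<close> and \<open>1\<close> of maximal size, and measure in units of its
  squared length \<open>T\<close>. All coordinates and inner products then lie in the ring, and squared areas
  that lie in the ring become multiples of \<open>\<epsilon>\<^sup>2\<close> with \<open>\<epsilon> = 1 / T\<close>. Heron's formula in these
  coordinates gives the face conditions.\<close>

lemma degenerate_axis_gram:
  assumes s: "squared_distances n s" and n: "1 \<le> n" and T: "s 0 1 = T" "T \<noteq> 0"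
    and T_max: "\<And>i j. i \<le> n \<Longrightarrow> j \<le> n \<Longrightarrow> s i j \<in> multiples T"
    and \<epsilon>: "T * \<epsilon> = 1" "noninvertible \<epsilon>"
    and area: "\<And>i j k. i \<le> n \<Longrightarrow> j \<le> n \<Longrightarrow> k \<le> n \<Longrightarrow> heron (s i j) (s j k) (s k i) \<in> B"
  shows "degenerate_triangles B (\<epsilon>\<^sup>2) {..<n - 1} (axis_coord s) (axis_gram s)"
proof -
  define a h where "a = axis_coord s" and "h = axis_gram s"
  define E where "E = multiples (\<epsilon>\<^sup>2)"
  have half: "x \<in> B" if "2 * x \<in> B" for x
    using multiples_cancel_invertible[of 2 x 1] that by simp
  have quarter: "x \<in> E" if "4 * x \<in> E" for x
    using multiples_cancel_invertible[of 4 x "\<epsilon>\<^sup>2"] that by (simp add: E_def)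
  have sB: "\<exists>c\<in>B. s i j = T * c" if "i \<le> n" "j \<le> n" for i j
    using T_max[OF that] by (auto elim: multiplesE)
  have s0: "s 0 (k + 2) = T * (h k k + (a k)\<^sup>2)" and s1: "s 1 (k + 2) = T * (h k k + (1 - a k)\<^sup>2)" 
    if "k < n - 1" for k
    using squared_distances_axis(1,2)[OF s n, of k k] that T by (simp_all add: a_def h_def)
  have skl: "s (k + 2) (l + 2) = T * (h k k + h l l + (a k - a l)\<^sup>2 - 2 * h k l)"
    if "k < n - 1" "l < n - 1" for k l
    using squared_distances_axis(3)[OF s n, of k l] that T by (simp add: a_def h_def)
  have sym: "s (k + 2) 0 = s 0 (k + 2)" "s (k + 2) 1 = s 1 (k + 2)" "s 0 1 = T" if "k < n - 1" for k
    using s that T by (auto simp: squared_distances_def)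
  have hsym: "h k l = h l k" if "k < n - 1" "l < n - 1" for k l
    using axis_gram_sym[OF s that] by (simp add: h_def)
  have le: "k + 2 \<le> n" if "k < n - 1" for k using that by simp
  have aB: "a k \<in> B" if k: "k < n - 1" for k
  proof -
    obtain c d where c: "c \<in> B" "s 0 (k + 2) = T * c" and d: "d \<in> B" "s 1 (k + 2) = T * d"
      using sB[OF _ le[OF k], of 0] sB[OF n le[OF k]] by auto
    have "2 * a k = 1 + c - d"
      unfolding a_def axis_coord_def c d T using T(2) by (simp add: field_simps)
    also have "\<dots> \<in> B" using c d by auto
    finally show ?thesis by (rule half)
  qed
  have hB: "h k l \<in> B" if k: "k < n - 1" "l < n - 1" for k l
  proof -
    obtain c d f where c: "c \<in> B" "s 0 (k + 2) = T * c" and d: "d \<in> B" "s 0 (l + 2) = T * d"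
      and f: "f \<in> B" "s (k + 2) (l + 2) = T * f"
      using sB[OF _ le[OF k(1)], of 0] sB[OF _ le[OF k(2)], of 0] sB[OF le[OF k(1)] le[OF k(2)]]
      by auto
    have "2 * h k l = c + d - f - 2 * a k * a l"
      unfolding h_def axis_gram_def a_def c d f T using T(2) by (simp add: field_simps)
    also have "\<dots> \<in> B" using c d f aB[OF k(1)] aB[OF k(2)] by auto
    finally show ?thesis by (rule half)
  qed
  have scaled: "heron x y z \<in> E" if "heron (T * x) (T * y) (T * z) \<in> B" for x y z
  proof -
    have "heron (T * x) (T * y) (T * z) = T\<^sup>2 * heron x y z"
      by (simp add: heron_def algebra_simps power2_eq_square)
    then have "\<epsilon>\<^sup>2 * heron (T * x) (T * y) (T * z) = (T * \<epsilon>)\<^sup>2 * heron x y z"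
      by (simp add: power_mult_distrib)
    then have "heron x y z = \<epsilon>\<^sup>2 * heron (T * x) (T * y) (T * z)" by (simp add: \<epsilon>(1))
    then show ?thesis unfolding E_def using that by (rule multiplesI)
  qed
  have diag: "h k k \<in> E" if k: "k < n - 1" for k
  proof -
    have "heron (T * 1) (T * (h k k + (1 - a k)\<^sup>2)) (T * (h k k + (a k)\<^sup>2)) \<in> B"
      using area[of 0 1 "k + 2"] n le[OF k] s0[OF k] s1[OF k] sym[OF k] by simp
    then have "heron 1 (h k k + (1 - a k)\<^sup>2) (h k k + (a k)\<^sup>2) \<in> E" by (rule scaled)
    also have "heron 1 (h k k + (1 - a k)\<^sup>2) (h k k + (a k)\<^sup>2) = 4 * h k k"
      by (simp add: heron_def algebra_simps power2_eq_square)
    finally show ?thesis by (rule quarter)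
  qed
  note closure = multiples_add[of _ "\<epsilon>\<^sup>2", folded E_def] multiples_diff[of _ "\<epsilon>\<^sup>2", folded E_def]
    multiples_uminus[of _ "\<epsilon>\<^sup>2", folded E_def]
  note dmul = multiples_mult_right[of _ "\<epsilon>\<^sup>2", folded E_def, OF diag]
  have face0: "h k l * (h k l + 2 * a k * a l) \<in> E" if kl: "k < n - 1" "l < n - 1" for k l
  proof -
    let ?H = "heron (h k k + (a k)\<^sup>2) (h k k + h l l + (a k - a l)\<^sup>2 - 2 * h k l) (h l l + (a l)\<^sup>2)"
    have H: "?H \<in> E"
      using area[of 0 "k + 2" "l + 2"] le kl s0[OF kl(1)] s0[OF kl(2)] sym[OF kl(2)] skl[OF kl]
      by (intro scaled) simp
    have "4 * (h k l * (h k l + 2 * a k * a l)) =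
        h k k * (4 * (h l l + (a l)\<^sup>2)) + h l l * (4 * (a k)\<^sup>2) - ?H"
      by (simp add: heron_def algebra_simps power2_eq_square)
    also have "\<dots> \<in> E" using kl by (intro closure dmul H add_closed diff_closed mult_closed power_closed numeral_closed one_closed aB hB) simp_all
    finally show ?thesis by (rule quarter)
  qed
  have face1: "h k l * (h k l + 2 * (1 - a k) * (1 - a l)) \<in> E" if kl: "k < n - 1" "l < n - 1" for k l
  proof -
    let ?H = "heron (h k k + (1 - a k)\<^sup>2) (h k k + h l l + (a k - a l)\<^sup>2 - 2 * h k l) (h l l + (1 - a l)\<^sup>2)"
    have H: "?H \<in> E"
      using area[of 1 "k + 2" "l + 2"] n le kl s1[OF kl(1)] s1[OF kl(2)] sym[OF kl(2)] skl[OF kl]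
      by (intro scaled) simp
    have "4 * (h k l * (h k l + 2 * (1 - a k) * (1 - a l))) =
        h k k * (4 * (h l l + (1 - a l)\<^sup>2)) + h l l * (4 * (1 - a k)\<^sup>2) - ?H"
      by (simp add: heron_def algebra_simps power2_eq_square)
    also have "\<dots> \<in> E" using kl by (intro closure dmul H add_closed diff_closed mult_closed power_closed numeral_closed one_closed aB hB) simp_all
    finally show ?thesis by (rule quarter)
  qed
  have face: "triangle_defect a h i j k \<in> E" if ijk: "i < n - 1" "j < n - 1" "k < n - 1" for i j k
  proof -
    let ?H = "heron (h i i + h j j + (a i - a j)\<^sup>2 - 2 * h i j)
        (h j j + h k k + (a j - a k)\<^sup>2 - 2 * h j k) (h k k + h i i + (a k - a i)\<^sup>2 - 2 * h i k)"
    have H: "?H \<in> E"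
      using area[of "i + 2" "j + 2" "k + 2"] le ijk skl[OF ijk(1,2)] skl[OF ijk(2,3)] skl[OF ijk(3,1)]
        hsym[OF ijk(3,1)]
      by (intro scaled) simp
    define u v where "u = a j - a i" and "v = a k - a i"
    have "4 * triangle_defect a h i j k =
        h i i * (4 * ((u - v)\<^sup>2 - 2 * h i j - 2 * h i k + h j j + h k k - 2 * (h j k - h i j - h i k)))
        + h j j * (4 * (v\<^sup>2 - 2 * h i k + h k k)) + h k k * (4 * (u\<^sup>2 - 2 * h i j)) - ?H"
      unfolding u_def v_def triangle_defect_def
      by (simp add: heron_def algebra_simps power2_eq_square)
    also have "\<dots> \<in> E" unfolding u_def v_def using ijk by (intro closure dmul H add_closed diff_closed mult_closed power_closed numeral_closed one_closed aB hB) simp_all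
    finally show ?thesis by (rule quarter)
  qed
  have "noninvertible (\<epsilon>\<^sup>2)"
    using noninvertible_mult[OF \<epsilon>(2), of \<epsilon>] \<epsilon>(2) by (simp add: noninvertible_def power2_eq_square)
  then show ?thesis
    using aB hB hsym diag face0 face1 face
    unfolding a_def h_def E_def
    by unfold_locales auto
qed

lemma exists_max_multiple:
  assumes "finite I" "I \<noteq> {}" shows "\<exists>i\<in>I. \<forall>j\<in>I. f j \<in> multiples (f i)"
  using assms
proof (induction I rule: finite_ne_induct)
  case (singleton i)
  then show ?case by (simp add: multiples_self)
next
  case (insert k I)
  then obtain i where i: "i \<in> I" "\<forall>j\<in>I. f j \<in> multiples (f i)" by blast
  show ?case
    using multiples_linear[of "f i" "f k"] i multiples_trans multiples_self by blast
qed

lemma det_closed: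
  assumes "\<And>k l. k < N \<Longrightarrow> l < N \<Longrightarrow> y k l \<in> B"
  shows "det (mat N N (\<lambda>(k, l). y k l)) \<in> B"
proof -
  have "(\<Prod>k=0..<N. mat N N (\<lambda>(k, l). y k l) $$ (k, \<pi> k)) \<in> B" if "\<pi> permutes {0..<N}" for \<pi>
    using permutes_in_image[OF that] assms by (intro prod_closed) auto
  then show ?thesis
    by (subst det_def') (auto simp: sign_def intro!: sum_closed uminus_closed)
qed

text \<open>If some squared distance is not in the ring, let \<open>T\<close> be the largest one. By \<open>cm_det_axis_gram\<close>
  the Cayley-Menger determinant is \<open>T ^ n\<close> times the determinant of the Gram matrix of order
  \<open>n - 1\<close>, up to a rational factor, and the latter determinant is a multiple of \<open>T ^ (- n)\<close>.\<close>

theorem cm_det_in: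
  assumes s: "squared_distances n s" and n: "even n" "6 \<le> n"
    and area: "\<And>i j k. i \<le> n \<Longrightarrow> j \<le> n \<Longrightarrow> k \<le> n \<Longrightarrow> heron (s i j) (s j k) (s k i) \<in> B"
  shows "cm_det n s \<in> B"
proof (cases "\<forall>i\<le>n. \<forall>j\<le>n. s i j \<in> B")
  case True
  then show ?thesis unfolding cm_det_def by (intro det_closed) (auto simp: cm_entry_def)
next
  case False
  obtain i j where ij: "i \<le> n" "j \<le> n" and max: "\<And>k l. k \<le> n \<Longrightarrow> l \<le> n \<Longrightarrow> s k l \<in> multiples (s i j)"
    using exists_max_multiple[of "{..n} \<times> {..n}" "\<lambda>(i, j). s i j"] by auto
  define T where "T = s i j"
  have T: "T \<notin> B" using False max multiples_subset unfolding T_def by blast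
  then have T0: "T \<noteq> 0" by auto
  then have "i \<noteq> j" using s ij by (auto simp: squared_distances_def T_def)
  then obtain \<pi> where \<pi>: "\<pi> permutes {0..<n + 1}" "\<pi> 0 = i" "\<pi> 1 = j"
    using permutation_with_two_values[of i "n + 1" j] ij n by auto
  have \<pi>_le: "\<pi> k \<le> n" if "k \<le> n" for k using permutes_in_image[OF \<pi>(1), of k] that by simp
  define s' where "s' k l = s (\<pi> k) (\<pi> l)" for k l
  define \<epsilon> where "\<epsilon> = inverse T"
  have \<epsilon>: "T * \<epsilon> = 1" "noninvertible \<epsilon>" "\<epsilon> \<in> B"
    using T T0 in_or_inverse_in[of T] by (auto simp: \<epsilon>_def noninvertible_def invertible_def)
  have s': "squared_distances n s'" using s \<pi>_le by (auto simp: squared_distances_def s'_def)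
  have T': "s' 0 1 = T" unfolding s'_def \<pi>(2,3) T_def ..
  have "degenerate_triangles B (\<epsilon>\<^sup>2) {..<n - 1} (axis_coord s') (axis_gram s')"
    by (rule degenerate_axis_gram[OF s' _ T' T0 _ \<epsilon>(1,2)])
      (use n area max \<pi>_le in \<open>auto simp: s'_def T_def\<close>)
  then have "det (mat (n - 1) (n - 1) (\<lambda>(k, l). axis_gram s' k l)) \<in> multiples (\<epsilon> ^ (n - 1 + 1))"
    by (rule det_degenerate_triangles) (use n in auto)
  then obtain c where c: "det (mat (n - 1) (n - 1) (\<lambda>(k, l). axis_gram s' k l)) = \<epsilon> ^ n * c" "c \<in> B"
    using n by (auto elim: multiplesE)
  have "cm_det n s = cm_det n s'"
    unfolding s'_def using cm_det_relabel[OF \<pi>(1), of s] by simp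
  also have "\<dots> = 2 * T * (- 2 * T) ^ (n - 1) * (\<epsilon> ^ n * c)"
    using cm_det_axis_gram[OF s'] n T' T0 c by simp
  also have "\<dots> = 2 * (- 2) ^ (n - 1) * (T * \<epsilon>) ^ n * c"
  proof -
    have "n = Suc (n - 1)" using n by simp
    then have "T ^ n = T * T ^ (n - 1)" by (metis power_Suc)
    then show ?thesis unfolding power_mult_distrib by (simp add: mult_ac)
  qed
  also have "\<dots> \<in> B" using c(2) unfolding \<epsilon>(1)
    by (intro mult_closed power_closed uminus_closed numeral_closed one_closed)
  finally show ?thesis .
qed

end

section \<open>Specialisation of algebraically independent elements\<close>

definition eval_monomial :: "('v \<Rightarrow> 'a::field_char_0) \<Rightarrow> ('v \<Rightarrow>\<^sub>0 nat) \<Rightarrow> 'a" where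
  "eval_monomial x m = (\<Prod>v\<in>Poly_Mapping.keys m. x v ^ Poly_Mapping.lookup m v)"

lemma eval_monomial_superset:
  assumes "finite S" "Poly_Mapping.keys m \<subseteq> S"
  shows "eval_monomial x m = (\<Prod>v\<in>S. x v ^ Poly_Mapping.lookup m v)"
  unfolding eval_monomial_def using assms
  by (intro prod.mono_neutral_left) (auto simp: in_keys_iff)

lemma eval_monomial_add: "eval_monomial x (m + m') = eval_monomial x m * eval_monomial x m'"
proof -
  let ?S = "Poly_Mapping.keys m \<union> Poly_Mapping.keys m'"
  have "finite ?S" "Poly_Mapping.keys (m + m') \<subseteq> ?S" using keys_add[of m m'] by auto
  then show ?thesis
    by (simp add: eval_monomial_superset[of ?S] lookup_add power_add prod.distrib)
qed

lemma eval_rat_mpoly_superset: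
  assumes "finite S" "Poly_Mapping.keys p \<subseteq> S"
  shows "eval_rat_mpoly x p = (\<Sum>m\<in>S. of_rat (Poly_Mapping.lookup p m) * eval_monomial x m)"
  unfolding eval_rat_mpoly_def eval_monomial_def[symmetric] using assms
  by (intro sum.mono_neutral_left) (auto simp: in_keys_iff)

lemma eval_rat_mpoly_zero: "eval_rat_mpoly x 0 = 0"
  by (simp add: eval_rat_mpoly_def)

lemma eval_rat_mpoly_add: "eval_rat_mpoly x (p + q) = eval_rat_mpoly x p + eval_rat_mpoly x q"
proof -
  let ?S = "Poly_Mapping.keys p \<union> Poly_Mapping.keys q"
  have "finite ?S" "Poly_Mapping.keys (p + q) \<subseteq> ?S" using keys_add[of p q] by auto
  then show ?thesis
    by (simp add: eval_rat_mpoly_superset[of ?S] lookup_add of_rat_add distrib_right sum.distrib)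
qed

lemma eval_rat_mpoly_sum: "eval_rat_mpoly x (sum f A) = (\<Sum>i\<in>A. eval_rat_mpoly x (f i))"
  by (induction A rule: infinite_finite_induct) (simp_all add: eval_rat_mpoly_zero eval_rat_mpoly_add)

lemma eval_rat_mpoly_single:
  "eval_rat_mpoly x (Poly_Mapping.single m c) = of_rat c * eval_monomial x m"
  by (simp add: eval_rat_mpoly_superset[of "{m}"])

lemma poly_mapping_sum_single:
  "p = (\<Sum>m\<in>Poly_Mapping.keys p. Poly_Mapping.single m (Poly_Mapping.lookup p m))"
  by (rule poly_mapping_eqI) (simp add: lookup_sum lookup_single when_def in_keys_iff sum.delta)

lemma eval_rat_mpoly_mult: "eval_rat_mpoly x (p * q) = eval_rat_mpoly x p * eval_rat_mpoly x q"
proof -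
  let ?P = "Poly_Mapping.keys p" and ?Q = "Poly_Mapping.keys q"
  have "p * q = (\<Sum>m\<in>?P. \<Sum>m'\<in>?Q. Poly_Mapping.single (m + m') (Poly_Mapping.lookup p m * Poly_Mapping.lookup q m'))"
    by (subst poly_mapping_sum_single[of p], subst poly_mapping_sum_single[of q])
      (simp add: sum_product mult_single)
  then show ?thesis
    by (simp add: eval_rat_mpoly_sum eval_rat_mpoly_single eval_monomial_add of_rat_mult
        eval_rat_mpoly_superset[of ?P] eval_rat_mpoly_superset[of ?Q] sum_product mult_ac)
qed

text \<open>The graph of the ring homomorphism on the polynomial ring generated by the \<open>x v\<close> that sends each
  \<open>x v\<close> to \<open>x' v\<close>. By \<open>specializes_zero\<close> below it is single-valued if the \<open>x v\<close> are algebraically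
  independent.\<close>

definition specializes_to ::
  "'v set \<Rightarrow> ('v \<Rightarrow> 'a::field_char_0) \<Rightarrow> ('v \<Rightarrow> 'a) \<Rightarrow> 'a \<Rightarrow> 'a \<Rightarrow> bool" where
  "specializes_to E x x' y y' \<longleftrightarrow>
     (\<exists>p. (\<forall>m\<in>Poly_Mapping.keys p. Poly_Mapping.keys m \<subseteq> E) \<and>
        y = eval_rat_mpoly x p \<and> y' = eval_rat_mpoly x' p)"

context
  fixes E :: "'v set" and x x' :: "'v \<Rightarrow> 'a::field_char_0"
begin

abbreviation Sp :: "'a \<Rightarrow> 'a \<Rightarrow> bool" where "Sp \<equiv> specializes_to E x x'"

lemma specializes_zero:
  assumes "rat_algebraically_independent x E" "Sp 0 y'" shows "y' = 0"
  using assms unfolding rat_algebraically_independent_def specializes_to_def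
  by (metis eval_rat_mpoly_zero)

lemma specializes_of_rat: "Sp (of_rat c) (of_rat c)"
  unfolding specializes_to_def
  by (rule exI[of _ "Poly_Mapping.single 0 c"]) (simp add: eval_rat_mpoly_single eval_monomial_def)

lemma specializes_var: "v \<in> E \<Longrightarrow> Sp (x v) (x' v)"
  unfolding specializes_to_def
  by (rule exI[of _ "Poly_Mapping.single (Poly_Mapping.single v 1) 1"])
    (simp add: eval_rat_mpoly_single eval_monomial_def)

lemma specializes_add: "Sp y y' \<Longrightarrow> Sp z z' \<Longrightarrow> Sp (y + z) (y' + z')"
proof -
  assume "Sp y y'" "Sp z z'"
  then obtain p q where p: "\<forall>m\<in>Poly_Mapping.keys p. Poly_Mapping.keys m \<subseteq> E"
      "y = eval_rat_mpoly x p" "y' = eval_rat_mpoly x' p"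
    and q: "\<forall>m\<in>Poly_Mapping.keys q. Poly_Mapping.keys m \<subseteq> E"
      "z = eval_rat_mpoly x q" "z' = eval_rat_mpoly x' q"
    unfolding specializes_to_def by blast
  show ?thesis unfolding specializes_to_def
    by (rule exI[of _ "p + q"]) (use p q keys_add[of p q] in \<open>auto simp: eval_rat_mpoly_add\<close>)
qed

lemma specializes_mult: "Sp y y' \<Longrightarrow> Sp z z' \<Longrightarrow> Sp (y * z) (y' * z')"
proof -
  assume "Sp y y'" "Sp z z'"
  then obtain p q where p: "\<forall>m\<in>Poly_Mapping.keys p. Poly_Mapping.keys m \<subseteq> E"
      "y = eval_rat_mpoly x p" "y' = eval_rat_mpoly x' p"
    and q: "\<forall>m\<in>Poly_Mapping.keys q. Poly_Mapping.keys m \<subseteq> E"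
      "z = eval_rat_mpoly x q" "z' = eval_rat_mpoly x' q"
    unfolding specializes_to_def by blast
  have "Poly_Mapping.keys m \<subseteq> E" if m: "m \<in> Poly_Mapping.keys (p * q)" for m
  proof -
    obtain a b where "m = a + b" "a \<in> Poly_Mapping.keys p" "b \<in> Poly_Mapping.keys q"
      using m keys_mult[of p q] by blast
    then show ?thesis using p q keys_add[of a b] by blast
  qed
  then show ?thesis unfolding specializes_to_def
    using p q by (intro exI[of _ "p * q"]) (auto simp: eval_rat_mpoly_mult)
qed

lemma specializes_zero_zero: "Sp 0 0" using specializes_of_rat[of 0] by simp
lemma specializes_one: "Sp 1 1" using specializes_of_rat[of 1] by simp
lemma specializes_numeral: "Sp (numeral k) (numeral k)" using specializes_of_rat[of "numeral k"] by simp

lemma specializes_uminus: "Sp y y' \<Longrightarrow> Sp (- y) (- y')"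
  using specializes_mult[OF specializes_of_rat[of "- 1"]] by simp

lemma specializes_diff: "Sp y y' \<Longrightarrow> Sp z z' \<Longrightarrow> Sp (y - z) (y' - z')"
  using specializes_add[of y y' "- z" "- z'"] specializes_uminus by simp

lemma specializes_sum: "(\<And>i. i \<in> A \<Longrightarrow> Sp (f i) (g i)) \<Longrightarrow> Sp (sum f A) (sum g A)"
  by (induction A rule: infinite_finite_induct) (auto intro: specializes_add specializes_zero_zero)

lemma specializes_prod: "(\<And>i. i \<in> A \<Longrightarrow> Sp (f i) (g i)) \<Longrightarrow> Sp (prod f A) (prod g A)"
  by (induction A rule: infinite_finite_induct) (auto intro: specializes_mult specializes_one)

lemma specializes_power: "Sp y y' \<Longrightarrow> Sp (y ^ k) (y' ^ k)"
  by (induction k) (auto intro: specializes_mult specializes_one)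

lemma specializes_det:
  assumes "\<And>i j. i < N \<Longrightarrow> j < N \<Longrightarrow> Sp (f i j) (g i j)"
  shows "Sp (det (mat N N (\<lambda>(i, j). f i j))) (det (mat N N (\<lambda>(i, j). g i j)))"
proof -
  have "Sp (\<Sum>\<pi> | \<pi> permutes {0..<N}. signof \<pi> * (\<Prod>i=0..<N. mat N N (\<lambda>(i, j). f i j) $$ (i, \<pi> i)))
      (\<Sum>\<pi> | \<pi> permutes {0..<N}. signof \<pi> * (\<Prod>i=0..<N. mat N N (\<lambda>(i, j). g i j) $$ (i, \<pi> i)))"
  proof (intro specializes_sum specializes_mult specializes_prod)
    fix \<pi> show "Sp (signof \<pi>) (signof \<pi>)"
      using specializes_one specializes_uminus by (auto simp: sign_def)
  next
    fix \<pi> i assume "\<pi> \<in> {\<pi>. \<pi> permutes {0..<N}}" "i \<in> {0..<N}"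
    then show "Sp (mat N N (\<lambda>(i, j). f i j) $$ (i, \<pi> i)) (mat N N (\<lambda>(i, j). g i j) $$ (i, \<pi> i))"
      using permutes_in_image[of \<pi> "{0..<N}" i] assms by simp
  qed
  then show ?thesis by (subst (1 2) det_def'[of _ N]) auto
qed

end

definition area_squares :: "nat \<Rightarrow> (nat \<Rightarrow> nat \<Rightarrow> 'a::field_char_0) \<Rightarrow> 'a set" where
  "area_squares n l = {area_square l i j k | i j k. i < j \<and> j < k \<and> k \<le> n}"

text \<open>An integral equation for the squared volume has coefficients that are polynomials in the squared
  areas. By independence of the lengths it remains valid under all substitutions \<open>m t\<close>. If these
  do not change the areas, then they do not change the coefficients either, so that infinitely many
  volumes would be roots of a single monic polynomial.\<close>

theorem volume_square_not_integral:
  fixes l :: "nat \<Rightarrow> nat \<Rightarrow> 'a::field_char_0" and m :: "'t \<Rightarrow> nat \<Rightarrow> nat \<Rightarrow> 'a"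
  assumes l: "independent_edge_lengths n l"
    and m_sym: "\<And>t i j. t \<in> P \<Longrightarrow> i \<le> n \<Longrightarrow> j \<le> n \<Longrightarrow> m t i j = m t j i"
    and areas: "\<And>t i j k. t \<in> P \<Longrightarrow> i < j \<Longrightarrow> j < k \<Longrightarrow> k \<le> n \<Longrightarrow> area_square (m t) i j k = \<sigma> i j k"
    and volumes: "infinite ((\<lambda>t. volume_square n (m t)) ` P)"
  shows "\<not> integral_over (rat_subalgebra (area_squares n l)) (volume_square n l)"
proof
  define x where "x = (\<lambda>(i, j). l i j)"
  define y where "y t = (\<lambda>(i, j). m t i j)" for t
  define S where "S t = specializes_to (edges n) x (y t)" for t
  note S = specializes_of_rat[of "edges n" x "y _", folded S_def]
    specializes_add[of "edges n" x "y _", folded S_def]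
    specializes_mult[of "edges n" x "y _", folded S_def]
    specializes_diff[of "edges n" x "y _", folded S_def]
    specializes_power[of "edges n" x "y _", folded S_def]
    specializes_numeral[of "edges n" x "y _", folded S_def]
    specializes_one[of "edges n" x "y _", folded S_def]
    specializes_zero_zero[of "edges n" x "y _", folded S_def]
  have l_sym: "l i j = l j i" if "i \<le> n" "j \<le> n" for i j
    using l that unfolding independent_edge_lengths_def by blast
  have indep: "rat_algebraically_independent x (edges n)"
    using l unfolding independent_edge_lengths_def x_def by blast
  have edge: "S t (l i j) (m t i j)" if "t \<in> P" "i \<le> n" "j \<le> n" "i \<noteq> j" for t i j
  proof -
    have less: "S t (l i j) (m t i j)" if "i < j" "j \<le> n" for i j
      using specializes_var[of "(i, j)" "edges n" x "y t"] that
      unfolding S_def by (simp add: edges_def x_def y_def)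
    show ?thesis
    proof (cases "i < j")
      case True then show ?thesis using less that by blast
    next
      case False
      then show ?thesis using less[of j i] that l_sym[of i j] m_sym[of t i j] by simp
    qed
  qed
  have area: "S t (area_square l i j k) (\<sigma> i j k)"
    if t: "t \<in> P" and ijk: "i < j" "j < k" "k \<le> n" for t i j k
  proof -
    have e: "S t (l i j) (m t i j)" "S t (l j k) (m t j k)" "S t (l k i) (m t k i)"
      using edge[OF t] ijk by auto
    have r: "S t (1 / 16) (1 / 16)" using S(1)[of t "1 / 16"] by (simp add: of_rat_divide)
    have "S t (area_square l i j k) (area_square (m t) i j k)"
      unfolding area_square_def Let_def by (intro S r e)
    then show ?thesis using areas[OF t ijk] by simp
  qed
  have volume: "S t (volume_square n l) (volume_square n (m t))" if t: "t \<in> P" for t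
  proof -
    have "of_rat (fact n) = (fact n :: 'a)" by (metis of_nat_fact of_rat_of_nat_eq)
    then have "S t ((-1) ^ (n + 1) / (2 ^ n * (fact n)\<^sup>2)) ((-1) ^ (n + 1) / (2 ^ n * (fact n)\<^sup>2))"
      using S(1)[of t "(-1) ^ (n + 1) / (2 ^ n * (fact n)\<^sup>2)"]
      by (simp add: of_rat_divide of_rat_power of_rat_mult of_rat_minus)
    moreover have "S t (det (cayley_menger_mat n l)) (det (cayley_menger_mat n (m t)))"
      unfolding cayley_menger_mat_def S_def
    proof (rule specializes_det, fold S_def)
      fix a b assume "a < n + 2" "b < n + 2"
      then show "S t (if a = b then 0 else if a = 0 \<or> b = 0 then 1 else (l (a - 1) (b - 1))\<^sup>2)
          (if a = b then 0 else if a = 0 \<or> b = 0 then 1 else (m t (a - 1) (b - 1))\<^sup>2)"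
        using S edge[OF t, of "a - 1" "b - 1"] by auto
    qed
    ultimately show ?thesis unfolding volume_square_def by (rule S(3))
  qed
  have coefficient: "\<exists>f. \<forall>t\<in>P. S t c f" if "c \<in> rat_subalgebra (area_squares n l)" for c
    using that
  proof induction
    case (of_rat q)
    then show ?case using S(1) by blast
  next
    case (gen g)
    then show ?case using area unfolding area_squares_def by blast
  next
    case (add c d)
    then show ?case using S(2) by meson
  next
    case (mult c d)
    then show ?case using S(3) by meson
  qed
  assume "integral_over (rat_subalgebra (area_squares n l)) (volume_square n l)"
  then obtain p where p: "lead_coeff p = 1" "\<And>i. coeff p i \<in> rat_subalgebra (area_squares n l)"
      "poly p (volume_square n l) = 0"
    unfolding integral_over_def by blast
  have "\<forall>i. \<exists>f. \<forall>t\<in>P. S t (coeff p i) f" using coefficient p(2) by blast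
  then obtain f where f: "\<And>i t. t \<in> P \<Longrightarrow> S t (coeff p i) (f i)" by metis
  define q where "q = (\<Sum>i\<le>degree p. monom (f i) i)"
  have root: "poly q (volume_square n (m t)) = 0" if t: "t \<in> P" for t
  proof -
    have "S t (\<Sum>i\<le>degree p. coeff p i * volume_square n l ^ i)
        (\<Sum>i\<le>degree p. f i * volume_square n (m t) ^ i)"
      unfolding S_def
      by (intro specializes_sum, fold S_def) (intro S f volume t)
    then have "S t 0 (poly q (volume_square n (m t)))"
      using p(3) by (simp add: q_def poly_sum poly_monom poly_altdef[of p])
    then show ?thesis unfolding S_def by (rule specializes_zero[OF indep])
  qed
  have "q \<noteq> 0"
  proof
    have "coeff q (degree p) = f (degree p)" by (simp add: q_def coeff_sum)
    moreover assume "q = 0"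
    ultimately have "f (degree p) = 0" by simp
    moreover obtain t where t: "t \<in> P" using volumes by fastforce
    ultimately have "S t (1 - 1) (0 - 1)" using f[OF t, of "degree p"] p(1) by (intro S(4) S(7)) auto
    then show False using specializes_zero[OF indep, of "y t" "- 1"] by (simp add: S_def)
  qed
  then have "finite {w. poly q w = 0}" by (rule poly_roots_finite)
  moreover have "(\<lambda>t. volume_square n (m t)) ` P \<subseteq> {w. poly q w = 0}" using root by auto
  ultimately show False using volumes finite_subset by blast
qed

section \<open>Families of simplices with constant areas\<close>

definition sqrt_choice :: "'a::alg_closed_field \<Rightarrow> 'a" where
  "sqrt_choice x = (SOME y. y\<^sup>2 = x)"

lemma sqrt_choice_power2 [simp]: "(sqrt_choice x)\<^sup>2 = x"
  unfolding sqrt_choice_def by (rule someI_ex[OF nth_root_exists]) simp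

lemma area_square_heron:
  "area_square l i j k = heron ((l i j)\<^sup>2) ((l j k)\<^sup>2) ((l k i)\<^sup>2) / 16"
  by (simp add: area_square_def heron_def Let_def)

lemma volume_square_cm_det:
  "volume_square n l = (-1) ^ (n + 1) / (2 ^ n * (fact n)\<^sup>2) * cm_det n (\<lambda>i j. (l i j)\<^sup>2)"
  by (simp add: volume_square_def cm_det_def cayley_menger_mat_def cm_entry_def)

text \<open>The family may be given by squared lengths, since the field is algebraically closed.\<close>

theorem volume_square_not_integral_family:
  fixes l :: "nat \<Rightarrow> nat \<Rightarrow> 'a::{alg_closed_field, field_char_0}" and s :: "'a \<Rightarrow> nat \<Rightarrow> nat \<Rightarrow> 'a"
  assumes l: "independent_edge_lengths n l"
    and s_sym: "\<And>t i j. t \<in> P \<Longrightarrow> i \<le> n \<Longrightarrow> j \<le> n \<Longrightarrow> s t i j = s t j i"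
    and areas: "\<And>t i j k. t \<in> P \<Longrightarrow> i < j \<Longrightarrow> j < k \<Longrightarrow> k \<le> n \<Longrightarrow>
      heron (s t i j) (s t j k) (s t k i) = \<sigma> i j k"
    and volumes: "infinite ((\<lambda>t. cm_det n (s t)) ` P)"
  shows "\<not> integral_over (rat_subalgebra (area_squares n l)) (volume_square n l)"
proof (rule volume_square_not_integral[OF l, where m = "\<lambda>t i j. sqrt_choice (s t i j)" and P = P and \<sigma> = "\<lambda>i j k. \<sigma> i j k / 16"])
  define c :: 'a where "c = (-1) ^ (n + 1) / (2 ^ n * (fact n)\<^sup>2)"
  have "c \<noteq> 0" by (simp add: c_def)
  then have "inj ((*) c)" by (auto intro: injI)
  then have "infinite ((*) c ` (\<lambda>t. cm_det n (s t)) ` P)"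
    using volumes by (meson finite_imageD inj_on_subset subset_UNIV)
  then show "infinite ((\<lambda>t. volume_square n (\<lambda>i j. sqrt_choice (s t i j))) ` P)"
    by (simp add: volume_square_cm_det image_image c_def)
qed (use s_sym areas in \<open>simp_all add: area_square_heron\<close>)

text \<open>The vertices form two groups, the first one consisting of the vertices below \<open>k\<close>. Distances
  within a group vanish, and squared distances between the groups are \<open>t\<close>, or \<open>t + 1\<close> for the
  pairs \<open>(i, i + k)\<close>. A triangle with two sides of squared lengths \<open>t + c\<close>, \<open>t + d\<close> and a third one
  of length \<open>0\<close> has squared area \<open>- (c - d)\<^sup>2 / 16\<close>, which does not depend on \<open>t\<close>.\<close>

definition split_simplex :: "nat \<Rightarrow> 'a::comm_ring_1 \<Rightarrow> nat \<Rightarrow> nat \<Rightarrow> 'a" where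
  "split_simplex k t i j =
     (if i < k \<longleftrightarrow> j < k then 0 else t + (if j = i + k \<or> i = j + k then 1 else 0))"

lemma split_simplex_areas:
  "heron (split_simplex m t i j) (split_simplex m t j k) (split_simplex m t k i) =
   heron (split_simplex m 0 i j) (split_simplex m 0 j k) (split_simplex m 0 k i)"
proof -
  have "heron 0 (c::'a) d = - (c - d)\<^sup>2" "heron c 0 d = - (c - d)\<^sup>2" "heron c d 0 = - (c - d)\<^sup>2" for c d
    by (simp_all add: heron_def algebra_simps power2_eq_square)
  then show ?thesis
    by (cases "i < m"; cases "j < m"; cases "k < m") (simp_all add: split_simplex_def)
qed

text \<open>Evaluation at \<open>t\<close> commutes with the determinant.\<close>

lemma split_simplex_cm_det_poly:
  "\<exists>p. \<forall>t::'a::comm_ring_1. cm_det n (split_simplex k t) = poly p t"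
proof (intro exI allI)
  fix t :: 'a
  define M :: "'a poly mat" where
    "M = mat (n + 2) (n + 2) (\<lambda>(r, c). cm_entry (split_simplex k [:0, 1:]) r c)"
  interpret h: comm_ring_hom "\<lambda>p. poly p t" by unfold_locales auto
  have "map_mat (\<lambda>p. poly p t) M = mat (n + 2) (n + 2) (\<lambda>(r, c). cm_entry (split_simplex k t) r c)"
    unfolding M_def by (intro eq_matI) (auto simp: cm_entry_def split_simplex_def)
  then show "cm_det n (split_simplex k t) =
      poly (det (mat (n + 2) (n + 2) (\<lambda>(r, c). cm_entry (split_simplex k [:0, 1:]) r c))) t"
    using h.hom_det[of M] unfolding cm_det_def M_def by simp
qed

lemma cm_mult_vec:
  fixes s :: "nat \<Rightarrow> nat \<Rightarrow> 'a::comm_ring_1"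
  assumes "r < n + 2"
  shows "(mat (n + 2) (n + 2) (\<lambda>(r, c). cm_entry s r c) *\<^sub>v vec (n + 2) v) $ r =
    cm_entry s r 0 * v 0 + (\<Sum>i\<le>n. cm_entry s r (Suc i) * v (Suc i))"
proof -
  have "(mat (n + 2) (n + 2) (\<lambda>(r, c). cm_entry s r c) *\<^sub>v vec (n + 2) v) $ r =
    (\<Sum>c\<in>{0..<Suc (n + 1)}. cm_entry s r c * v c)"
    using assms by (simp add: scalar_prod_def)
  also have "\<dots> = cm_entry s r 0 * v 0 + (\<Sum>i\<le>n. cm_entry s r (Suc i) * v (Suc i))"
    unfolding sum.atLeast0_lessThan_Suc_shift by (simp add: atLeast0LessThan lessThan_Suc_atMost)
  finally show ?thesis .
qed

lemma cm_row_vertex: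
  fixes s :: "nat \<Rightarrow> nat \<Rightarrow> 'a::comm_ring_1"
  assumes "i \<le> n" "s i i = 0"
  shows "cm_entry s (Suc i) 0 * v 0 + (\<Sum>j\<le>n. cm_entry s (Suc i) (Suc j) * v (Suc j)) =
    v 0 + (\<Sum>j\<le>n. s i j * v (Suc j))"
  using assms by (auto simp: cm_entry_def intro!: arg_cong2[of _ _ _ _ "(+)"] sum.cong)

lemma sum_split_simplex_row:
  fixes t :: "'a::comm_ring_1"
  assumes n: "n + 1 = 2 * k" and i: "i \<le> n"
  shows "(\<Sum>j\<le>n. split_simplex k t i j * v j) =
    t * (if i < k then (\<Sum>j\<in>{k..<2 * k}. v j) else (\<Sum>j<k. v j)) + v (if i < k then i + k else i - k)"
proof -
  have U: "{..n} = {..<k} \<union> {k..<2 * k}" using n by auto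
  have "(\<Sum>j\<le>n. split_simplex k t i j * v j) =
     (\<Sum>j<k. split_simplex k t i j * v j) + (\<Sum>j\<in>{k..<2 * k}. split_simplex k t i j * v j)"
    unfolding U by (rule sum.union_disjoint) auto
  moreover have "(\<Sum>j\<in>{k..<2 * k}. split_simplex k t i j * v j) =
      t * (\<Sum>j\<in>{k..<2 * k}. v j) + v (i + k)" if "i < k"
  proof -
    have "(\<Sum>j\<in>{k..<2 * k}. split_simplex k t i j * v j) =
        (\<Sum>j\<in>{k..<2 * k}. t * v j + (if j = i + k then v j else 0))"
      using that by (intro sum.cong) (auto simp: split_simplex_def algebra_simps)
    then show ?thesis using that by (simp add: sum.distrib sum_distrib_left)
  qed
  moreover have "(\<Sum>j<k. split_simplex k t i j * v j) = t * (\<Sum>j<k. v j) + v (i - k)" if "\<not> i < k"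
  proof -
    have "(\<Sum>j<k. split_simplex k t i j * v j) = (\<Sum>j<k. t * v j + (if j = i - k then v j else 0))"
      using that by (intro sum.cong) (auto simp: split_simplex_def algebra_simps)
    then show ?thesis using that i n by (simp add: sum.distrib sum_distrib_left)
  qed
  moreover have "(\<Sum>j<k. split_simplex k t i j * v j) = 0" if "i < k"
    using that by (intro sum.neutral) (auto simp: split_simplex_def)
  moreover have "(\<Sum>j\<in>{k..<2 * k}. split_simplex k t i j * v j) = 0" if "\<not> i < k"
    using that by (intro sum.neutral) (auto simp: split_simplex_def)
  ultimately show ?thesis by auto
qed

lemma split_simplex_diag: "split_simplex k t i i = 0"
  by (simp add: split_simplex_def)

text \<open>The vector that is \<open>1\<close> on the first group of vertices, \<open>-1\<close> on the second one and \<open>0\<close> at \<open>*\<close> is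
  in the kernel.\<close>

lemma split_simplex_singular:
  fixes t :: "'a::field_char_0"
  assumes n: "n + 1 = 2 * k" and t: "of_nat k * t = - 1"
  shows "cm_det n (split_simplex k t) = 0"
proof -
  let ?M = "mat (n + 2) (n + 2) (\<lambda>(r, c). cm_entry (split_simplex k t) r c)"
  define v :: "nat \<Rightarrow> 'a" where "v r = (if r = 0 then 0 else if r - 1 < k then 1 else - 1)" for r
  have U: "{..n} = {..<k} \<union> {k..<2 * k}" using n by auto
  have halves: "(\<Sum>j<k. v (Suc j)) = of_nat k" "(\<Sum>j\<in>{k..<2 * k}. v (Suc j)) = - of_nat k"
    by (simp_all add: v_def)
  have "(?M *\<^sub>v vec (n + 2) v) $ r = 0" if r: "r < n + 2" for r
  proof (cases r)
    case 0
    have "(\<Sum>j\<le>n. v (Suc j)) = 0"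
      unfolding U using halves by (subst sum.union_disjoint) auto
    then show ?thesis unfolding cm_mult_vec[OF r] using 0 by (simp add: cm_entry_def)
  next
    case (Suc i)
    then have i: "i \<le> n" using r by simp
    show ?thesis
      unfolding cm_mult_vec[OF r] unfolding Suc cm_row_vertex[where v = v, OF i split_simplex_diag]
        sum_split_simplex_row[OF n i] halves
      using t i n by (simp add: v_def mult.commute) linarith
  qed
  then have "?M *\<^sub>v vec (n + 2) v = 0\<^sub>v (n + 2)" by (intro eq_vecI) auto
  moreover have "vec (n + 2) v \<noteq> 0\<^sub>v (n + 2)"
  proof
    assume "vec (n + 2) v = 0\<^sub>v (n + 2)"
    then have "vec (n + 2) v $ 1 = 0\<^sub>v (n + 2) $ 1" by simp
    then show False using n by (simp add: v_def)
  qed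
  ultimately show ?thesis
    unfolding cm_det_def det_0_iff_vec_prod_zero_field[OF mat_carrier] using vec_carrier by blast
qed

text \<open>For \<open>t = 0\<close>, the row of the vertex opposite to \<open>j\<close> shows that a kernel vector has the entry
  \<open>- v 0\<close> at \<open>j\<close>, and the row \<open>*\<close> shows that these entries add up to \<open>0\<close>.\<close>

lemma split_simplex_nonsingular:
  assumes n: "n + 1 = 2 * k"
  shows "cm_det n (split_simplex k (0::'a::field_char_0)) \<noteq> 0"
proof
  let ?M = "mat (n + 2) (n + 2) (\<lambda>(r, c). cm_entry (split_simplex k (0::'a)) r c)"
  assume "cm_det n (split_simplex k (0::'a)) = 0"
  then obtain w where w: "w \<in> carrier_vec (n + 2)" "w \<noteq> 0\<^sub>v (n + 2)" "?M *\<^sub>v w = 0\<^sub>v (n + 2)"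
    unfolding cm_det_def det_0_iff_vec_prod_zero_field[OF mat_carrier] by blast
  define v where "v r = w $ r" for r
  have wv: "w = vec (n + 2) v" using w(1) by (intro eq_vecI) (auto simp: v_def)
  have row: "cm_entry (split_simplex k 0) r 0 * v 0 +
      (\<Sum>i\<le>n. cm_entry (split_simplex k 0) r (Suc i) * v (Suc i)) = 0" if r: "r < n + 2" for r
    unfolding cm_mult_vec[OF r, symmetric] w(3)[unfolded wv] using r by simp
  have all: "v (Suc j) = - v 0" if "j \<le> n" for j
  proof -
    define i where "i = (if j < k then j + k else j - k)"
    have i: "i \<le> n" "(if i < k then i + k else i - k) = j" using that n by (auto simp: i_def)
    have "v 0 + (\<Sum>j\<le>n. split_simplex k 0 i j * v (Suc j)) = 0"
      using row[of "Suc i"] i(1) cm_row_vertex[where s = "split_simplex k 0" and v = v, OF i(1) split_simplex_diag]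
      by simp
    then have "v 0 + v (Suc j) = 0"
      unfolding sum_split_simplex_row[OF n i(1)] i(2) by simp
    then show ?thesis by (simp add: add_eq_0_iff)
  qed
  have "(\<Sum>i\<le>n. v (Suc i)) = 0" using row[of 0] by (simp add: cm_entry_def)
  then have "of_nat (n + 1) * v 0 = 0" using all by simp
  then have "v 0 = 0" by (metis mult_eq_0_iff of_nat_eq_0_iff add_is_0 one_neq_zero)
  then have "v r = 0" if "r < n + 2" for r using all[of "r - 1"] that by (cases r) auto
  then have "w = 0\<^sub>v (n + 2)" unfolding wv by (intro eq_vecI) auto
  then show False using w by simp
qed

text \<open>The volume of \<open>split_simplex\<close> is a polynomial in \<open>t\<close> with a zero that does not vanish at \<open>0\<close>, so
  it takes infinitely many values.\<close>

lemma not_integral_odd: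
  fixes l :: "nat \<Rightarrow> nat \<Rightarrow> 'a::{alg_closed_field, field_char_0}"
  assumes l: "independent_edge_lengths n l" and "odd n"
  shows "\<not> integral_over (rat_subalgebra (area_squares n l)) (volume_square n l)"
proof -
  define k where "k = (n + 1) div 2"
  have n: "n + 1 = 2 * k" using \<open>odd n\<close> by (simp add: k_def)
  have "k \<noteq> 0" using n by auto
  then have k: "(of_nat k :: 'a) \<noteq> 0" by simp
  obtain p where p: "\<And>t::'a. cm_det n (split_simplex k t) = poly p t"
    using split_simplex_cm_det_poly by blast
  have "infinite ((\<lambda>t::'a. cm_det n (split_simplex k t)) ` UNIV)"
  proof
    assume "finite ((\<lambda>t::'a. cm_det n (split_simplex k t)) ` UNIV)"
    then obtain c where "infinite {t::'a. poly p t = poly p c}"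
      using inf_img_fin_domE[of "poly p" UNIV] infinite_UNIV_char_0 p
      by (auto simp: vimage_def)
    then have "infinite {t. poly (p - [:poly p c:]) t = 0}" by simp
    then have "p - [:poly p c:] = 0" using poly_roots_finite by blast
    then have p_eq: "p = [:poly p c:]" by simp
    have const: "poly p t = poly p c" for t by (subst p_eq) simp
    have "poly p (- 1 / of_nat k) = 0"
      using split_simplex_singular[OF n, of "- 1 / of_nat k :: 'a"] k p by simp
    then have "poly p 0 = 0" using const by metis
    then show False using split_simplex_nonsingular[OF n, where 'a = 'a] p by simp
  qed
  moreover have "split_simplex k t i j = split_simplex k t j i" for t :: 'a and i j
    by (auto simp: split_simplex_def)
  ultimately show ?thesis
    using split_simplex_areas
    by (intro volume_square_not_integral_family[OF l, where s = "split_simplex k" and P = UNIV])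
qed

text \<open>Squared distances of a tetrahedron with edge lengths \<open>1\<close>, \<open>1\<close>, \<open>2\<close> in every face: the faces are
  degenerate, the volume is not zero.\<close>

definition tetra :: "nat \<Rightarrow> nat \<Rightarrow> 'a::comm_ring_1" where
  "tetra i j = (if i = j then 0 else if i + j = 3 then 4 else 1)"

text \<open>The tetrahedron is scaled so that its squared distances are multiplied by \<open>t\<close>, and the vertex \<open>4\<close>
  is placed over the vertex \<open>0\<close> at squared height \<open>1 / t\<close>, orthogonally to the tetrahedron. A face
  through the vertex \<open>4\<close> and the edge \<open>i j\<close> then has the squared area \<open>tetra i j / 4\<close>, while the squared
  volume grows like \<open>t\<^sup>3 \<cdot> (1 / t)\<close>.\<close>

definition apex_simplex :: "'a::field \<Rightarrow> nat \<Rightarrow> nat \<Rightarrow> 'a" where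
  "apex_simplex t i j =
     (if i = j then 0 else if i = 4 then t * tetra 0 j + 1 / t
      else if j = 4 then t * tetra 0 i + 1 / t else t * tetra i j)"

lemma apex_simplex_areas:
  fixes t :: "'a::field"
  assumes "t \<noteq> 0" "i < j" "j < k" "k \<le> 4"
  shows "heron (apex_simplex t i j) (apex_simplex t j k) (apex_simplex t k i) =
    (if k = 4 then 4 * tetra i j else 0)"
proof -
  have "i \<in> {0, 1, 2}" "j \<in> {1, 2, 3}" "k \<in> {2, 3, 4}" using assms by auto
  then show ?thesis using assms
    by (auto simp: apex_simplex_def tetra_def heron_def field_simps power2_eq_square)
qed

lemma apex_simplex_cm_det:
  fixes t :: "'a::field_char_0"
  assumes t: "t \<noteq> 0"
  shows "cm_det 4 (apex_simplex t) = 256 * t\<^sup>2"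
proof -
  let ?s = "apex_simplex t"
  have s: "squared_distances 4 ?s"
    by (auto simp: squared_distances_def apex_simplex_def tetra_def add.commute)
  have coord: "axis_coord ?s 0 = - 1" "axis_coord ?s 1 = 2" "axis_coord ?s 2 = 0"
    using t by (simp_all add: axis_coord_def apex_simplex_def tetra_def field_simps)
  have gram: "axis_gram ?s 0 0 = 0" "axis_gram ?s 0 1 = 4" "axis_gram ?s 0 2 = 0"
    "axis_gram ?s 1 0 = 4" "axis_gram ?s 1 1 = 0" "axis_gram ?s 1 2 = 0"
    "axis_gram ?s 2 0 = 0" "axis_gram ?s 2 1 = 0" "axis_gram ?s 2 2 = 1 / t\<^sup>2"
    unfolding axis_gram_def coord
    using t by (simp_all add: apex_simplex_def tetra_def field_simps power2_eq_square)
  have "det (mat (2 + 1) (2 + 1) (\<lambda>(k, l). axis_gram ?s k l)) =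
    det (mat 2 2 (\<lambda>(k, l). axis_gram ?s k l)) *
    det (mat 1 1 (\<lambda>(k, l). axis_gram ?s (2 + k) (2 + l) - (\<Sum>c<2. axis_gram ?s (2 + k) c * 0)))"
    by (rule det_schur_complement) (use gram in \<open>auto simp: less_2_cases_iff\<close>)
  also have "\<dots> = - 16 / t\<^sup>2"
    unfolding det_mat_2 using gram by (simp add: det_single numeral_2_eq_2)
  finally have "det (mat 3 3 (\<lambda>(k, l). axis_gram ?s k l)) = - 16 / t\<^sup>2" by simp
  moreover have "?s 0 1 = t" by (simp add: apex_simplex_def tetra_def)
  ultimately show ?thesis
    using cm_det_axis_gram[OF s] t by (simp add: power2_eq_square power3_eq_cube)
qed

lemma not_integral_4:
  fixes l :: "nat \<Rightarrow> nat \<Rightarrow> 'a::{alg_closed_field, field_char_0}"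
  assumes l: "independent_edge_lengths 4 l"
  shows "\<not> integral_over (rat_subalgebra (area_squares 4 l)) (volume_square 4 l)"
proof -
  have infinite: "infinite ((\<lambda>t::'a. cm_det 4 (apex_simplex t)) ` (- {0}))"
  proof
    assume fin: "finite ((\<lambda>t::'a. cm_det 4 (apex_simplex t)) ` (- {0}))"
    have "x \<in> (\<lambda>t::'a. cm_det 4 (apex_simplex t)) ` (- {0})" if "x \<noteq> 0" for x
    proof (rule image_eqI[of _ _ "sqrt_choice (x / 256)"])
      have "(sqrt_choice (x / 256))\<^sup>2 \<noteq> 0" using that by simp
      then have "sqrt_choice (x / 256) \<noteq> 0" by fastforce
      then show "sqrt_choice (x / 256) \<in> - {0}" "x = cm_det 4 (apex_simplex (sqrt_choice (x / 256)))"
        by (simp_all add: apex_simplex_cm_det)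
    qed
    then have "- {0::'a} \<subseteq> (\<lambda>t::'a. cm_det 4 (apex_simplex t)) ` (- {0})" by blast
    then have "finite (- {0::'a})" using fin finite_subset by blast
    then show False using infinite_UNIV_char_0 by (metis finite_compl finite.intros)
  qed
  show ?thesis
  proof (rule volume_square_not_integral_family[OF l _ _ infinite])
    fix t :: 'a and i j :: nat
    show "apex_simplex t i j = apex_simplex t j i"
      by (auto simp: apex_simplex_def tetra_def add.commute)
  next
    fix t :: 'a and i j k :: nat
    assume "t \<in> - {0}" "i < j" "j < k" "k \<le> 4"
    then show "heron (apex_simplex t i j) (apex_simplex t j k) (apex_simplex t k i) =
        (if k = 4 then 4 * tetra i j else 0)"
      by (intro apex_simplex_areas) auto
  qed
qed

section \<open>Integrality of the volume\<close>

theorem theorem1p5: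
  fixes n :: nat
    and l :: "nat \<Rightarrow> nat \<Rightarrow> 'a::{alg_closed_field, field_char_0}"
    and A :: "nat \<Rightarrow> nat \<Rightarrow> nat \<Rightarrow> 'a"
    and V :: 'a
  assumes "n \<ge> 3"
    and "independent_edge_lengths n l"
    and "\<And>i j k. i < j \<Longrightarrow> j < k \<Longrightarrow> k \<le> n \<Longrightarrow>
           A i j k \<in> length_field_closure n l \<and> (A i j k)\<^sup>2 = area_square l i j k"
    and "V \<in> length_field_closure n l" and "V\<^sup>2 = volume_square n l"
  shows "integral_over (area_ring n A) V \<longleftrightarrow> even n \<and> n \<ge> 6"
proof
  have AS: "(A i j k)\<^sup>2 = area_square l i j k" if "i < j" "j < k" "k \<le> n" for i j k
    using assms(3)[OF that] by blast
  assume integral: "integral_over (area_ring n A) V"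
  show "even n \<and> n \<ge> 6"
  proof (rule ccontr)
    assume "\<not> (even n \<and> n \<ge> 6)"
    moreover have "n = 4" if "even n" "n < 6"
    proof -
      have "n = 3 \<or> n = 4 \<or> n = 5" using assms(1) that by auto
      then show ?thesis using that by auto
    qed
    ultimately have "odd n \<or> n = 4" by auto
    then have "\<not> integral_over (rat_subalgebra (area_squares n l)) (volume_square n l)"
      using not_integral_odd not_integral_4 assms(2) by blast
    then obtain D where D: "valuation_ring D" "rat_subalgebra (area_squares n l) \<subseteq> D"
        "volume_square n l \<notin> D"
      using rat_algebra.exists_valuation_ring[OF rat_algebra_rat_subalgebra] by blast
    interpret D: valuation_ring D by fact
    have "A i j k \<in> D" if "i < j" "j < k" "k \<le> n" for i j k
    proof (rule D.in_if_square_in)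
      have "area_square l i j k \<in> rat_subalgebra (area_squares n l)"
        using that by (intro rat_subalgebra.gen) (auto simp: area_squares_def)
      then show "(A i j k)\<^sup>2 \<in> D" using AS[OF that] D(2) by auto
    qed
    then have "area_ring n A \<subseteq> D"
      unfolding area_ring_def by (intro D.rat_subalgebra_least) blast
    then have "integral_over D V" using integral unfolding integral_over_def by blast
    then have "V \<in> D" by (rule D.integrally_closed)
    then have "V\<^sup>2 \<in> D" by (rule D.power_closed)
    then show False using D(3) assms(5) by simp
  qed
next
  have AS: "(A i j k)\<^sup>2 = area_square l i j k" if "i < j" "j < k" "k \<le> n" for i j k
    using assms(3)[OF that] by blast
  assume n: "even n \<and> n \<ge> 6"
  show "integral_over (area_ring n A) V"
  proof (rule ccontr)
    assume "\<not> integral_over (area_ring n A) V"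
    then obtain D where D: "valuation_ring D" "area_ring n A \<subseteq> D" "V \<notin> D"
      using rat_algebra.exists_valuation_ring rat_algebra_rat_subalgebra unfolding area_ring_def by blast
    interpret D: valuation_ring D by fact
    define s where "s i j = (if i = j then 0 else (l i j)\<^sup>2)" for i j
    have s: "squared_distances n s"
      using assms(2) by (auto simp: squared_distances_def s_def independent_edge_lengths_def)
    have s_sym: "s i j = s j i" if "i \<le> n" "j \<le> n" for i j
      using s that by (simp add: squared_distances_def)
    \<comment> \<open>Areas are given for increasing indices; Heron's formula is symmetric.\<close>
    have sorted: "heron (s i j) (s j k) (s k i) \<in> D" if "i < j" "j < k" "k \<le> n" for i j k
    proof -
      have "A i j k \<in> area_ring n A"
        unfolding area_ring_def using that by (intro rat_subalgebra.gen) blast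
      then have "A i j k \<in> D" using D(2) by blast
      then have "16 * (A i j k)\<^sup>2 \<in> D" by auto
      then show ?thesis using that by (simp add: AS area_square_heron s_def)
    qed
    have heron_perm: "heron x y z = heron y x z" "heron x y z = heron x z y" for x y z :: 'a
      by (simp_all add: heron_def algebra_simps)
    have heron_eq: "heron 0 x x = 0" for x :: 'a by (simp add: heron_def power2_eq_square algebra_simps)
    have area: "heron (s i j) (s j k) (s k i) \<in> D" if ijk: "i \<le> n" "j \<le> n" "k \<le> n" for i j k
    proof (cases "i = j \<or> j = k \<or> k = i")
      case True
      then have "heron (s i j) (s j k) (s k i) = 0"
        using heron_eq heron_perm s_sym ijk by (auto simp: s_def) metis+
      then show ?thesis by simp
    next
      case False
      then consider "i < j" "j < k" | "j < k" "k < i" | "k < i" "i < j"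
        | "k < j" "j < i" | "j < i" "i < k" | "i < k" "k < j" by linarith
      then show ?thesis
        using sorted[of i j k] sorted[of j k i] sorted[of k i j] sorted[of k j i] sorted[of j i k]
          sorted[of i k j] ijk s_sym heron_perm
        by cases metis+
    qed
    have "V\<^sup>2 \<in> D"
      unfolding assms(5) volume_square_cm_det
    proof (rule D.mult_closed)
      have "of_rat (fact n) = (fact n :: 'a)" by (metis of_nat_fact of_rat_of_nat_eq)
      then show "(-1) ^ (n + 1) / (2 ^ n * (fact n)\<^sup>2) \<in> D"
        using D.of_rat_closed[of "(-1) ^ (n + 1) / (2 ^ n * (fact n)\<^sup>2)"]
        by (simp add: of_rat_divide of_rat_power of_rat_mult of_rat_minus)
      have "cm_det n (\<lambda>i j. (l i j)\<^sup>2) = cm_det n s"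
        unfolding cm_det_def
        by (intro arg_cong[of _ _ det] eq_matI) (auto simp: cm_entry_def s_def)
      then show "cm_det n (\<lambda>i j. (l i j)\<^sup>2) \<in> D" using D.cm_det_in[OF s _ _ area] n by simp
    qed
    then show False using D(3) D.in_if_square_in by blast
  qed
qed

end
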